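(* Let $\mathbb{F}$ be a dense subfield of $\mathbb{C}$, equipped with the topology inherited from $\mathbb{C}$, and let $n\in\mathbb{N}$ with $n\ge 1$. Then: (1) $\mathrm{SL}(n,\mathbb{F})$ is totally minimal if and only if $\rho_n\in\mathbb{F}$; (2) $\mathrm{SL}(n,\mathbb{F})$ is minimal if and only if $\langle\rho_m\rangle\cap\mathbb{F}\neq\{1\}$ for every integer $m>1$ dividing $n$.
   Context: All topological groups are Hausdorff. For $m\ge 1$, $\rho_m=e^{2\pi i/m}$ is the $m$-th primitive root of unity and $\langle\rho_m\rangle$ is the (multiplicative) cyclic group it generates. $\mathrm{SL}(n,\mathbb{F})$ denotes the special linear group of degree $n$ over $\mathbb{F}$ with the topology inherited from $\mathbb{F}^{n^2}$. A topological group $G$ is minimal if every continuous group isomorphism $f\colon G\to H$ onto a (Hausdorff) topological group $H$ is a topological isomorphism; equivalently, if $G$ admits no strictly coarser Hausdorff group topology. $G$ is totally minimal if $G/N$ (with the quotient topology) is minimal for every closed normal subgroup $N$ of $G$. *)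

theory Defs
  imports "HOL-Analysis.Analysis" "HOL-Algebra.Algebraic_Closure_Type"
begin

unbundle no fps_syntax

section \<open>Topological groups\<close>

text \<open>Groups are carrier-based, and the topology is a separate object living on the carrier.
  All topological groups are Hausdorff.\<close>

definition topological_group :: "('a, 'b) monoid_scheme \<Rightarrow> 'a topology \<Rightarrow> bool" where
  "topological_group G T \<longleftrightarrow>
     Group.group G \<and> topspace T = carrier G \<and> Hausdorff_space T \<and>
     continuous_map (prod_topology T T) T (\<lambda>(x, y). x \<otimes>\<^bsub>G\<^esub> y) \<and>
     continuous_map T T (\<lambda>x. inv\<^bsub>G\<^esub> x)"

definition minimal_group :: "('a, 'b) monoid_scheme \<Rightarrow> 'a topology \<Rightarrow> bool" where
  "minimal_group G T \<longleftrightarrow>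
     topological_group G T \<and>
     (\<forall>T'. topological_group G T' \<and> (\<forall>U. openin T' U \<longrightarrow> openin T U) \<longrightarrow> T' = T)"

text \<open>The formulation by continuous isomorphisms quantifies over all topological groups and
  hence over all types, so it cannot be the definiens; the next two lemmas recover it.\<close>

lemma minimal_groupD_iso:
  fixes G :: "('a, 'c) monoid_scheme" and H :: "('b, 'd) monoid_scheme"
  assumes min: "minimal_group G T" and H: "topological_group H S"
    and f: "f \<in> iso G H" and cont: "continuous_map T S f"
  shows "homeomorphic_map T S f"
proof -
  have G: "topological_group G T" using min by (simp add: minimal_group_def)
  interpret G: Group.group G using G by (simp add: topological_group_def)
  interpret H: Group.group H using H by (simp add: topological_group_def)
  interpret h: group_hom G H f
    using f by (unfold_locales) (auto simp: iso_def)
  have tG: "topspace T = carrier G" and tH: "topspace S = carrier H"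
    using G H by (auto simp: topological_group_def)
  have inj: "inj_on f (carrier G)" and im: "f ` carrier G = carrier H"
    using f by (auto simp: iso_def bij_betw_def)
  define T' where "T' = pullback_topology (carrier G) f S"
  have tT': "topspace T' = carrier G"
    using im by (auto simp: T'_def topspace_pullback_topology tH)
  have cf: "continuous_map T' S f"
    using continuous_map_pullback[of S S id "carrier G" f] by (simp add: T'_def)
  have "topological_group G T'"
    unfolding topological_group_def
  proof (intro conjI)
    show "Hausdorff_space T'"
      using Hausdorff_space_injective_preimage[OF _ cf] H inj
      by (simp add: tT' topological_group_def)
    have "continuous_map (prod_topology T' T') (prod_topology S S) (\<lambda>z. (f (fst z), f (snd z)))"
      by (intro continuous_map_pairedI continuous_map_compose[OF continuous_map_fst cf, unfolded o_def]
          continuous_map_compose[OF continuous_map_snd cf, unfolded o_def])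
    moreover have "continuous_map (prod_topology S S) S (\<lambda>(x, y). x \<otimes>\<^bsub>H\<^esub> y)"
      using H by (simp add: topological_group_def)
    ultimately have "continuous_map (prod_topology T' T') S
        ((\<lambda>(x, y). x \<otimes>\<^bsub>H\<^esub> y) \<circ> (\<lambda>z. (f (fst z), f (snd z))))"
      by (rule continuous_map_compose)
    then have "continuous_map (prod_topology T' T') S (f \<circ> (\<lambda>(x, y). x \<otimes>\<^bsub>G\<^esub> y))"
      by (rule continuous_map_eq) (auto simp: tT')
    then show "continuous_map (prod_topology T' T') T' (\<lambda>(x, y). x \<otimes>\<^bsub>G\<^esub> y)"
      unfolding T'_def by (rule continuous_map_pullback') (auto simp: tT'[unfolded T'_def])
    have "continuous_map T' S ((\<lambda>x. inv\<^bsub>H\<^esub> x) \<circ> f)"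
      using cf H by (auto simp: topological_group_def intro: continuous_map_compose)
    then have "continuous_map T' S (f \<circ> (\<lambda>x. inv\<^bsub>G\<^esub> x))"
      by (rule continuous_map_eq) (auto simp: tT')
    then show "continuous_map T' T' (\<lambda>x. inv\<^bsub>G\<^esub> x)"
      unfolding T'_def by (rule continuous_map_pullback') (auto simp: tT'[unfolded T'_def])
  qed (auto simp: tT')
  moreover have "openin T U" if "openin T' U" for U
  proof -
    from that obtain V where V: "openin S V" "U = f -` V \<inter> carrier G"
      by (auto simp: T'_def openin_pullback_topology)
    then have "U = {x \<in> topspace T. f x \<in> V}" by (auto simp: tG)
    then show ?thesis using cont V(1) by (auto simp: continuous_map_def)
  qed
  ultimately have eq: "T' = T" using min by (auto simp: minimal_group_def)
  have "open_map T S f"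
    unfolding open_map_def
  proof (intro allI impI)
    fix U assume "openin T U"
    then obtain V where V: "openin S V" "U = f -` V \<inter> carrier G"
      unfolding eq[symmetric] by (auto simp: T'_def openin_pullback_topology)
    moreover have "V \<subseteq> carrier H" using openin_subset[OF V(1)] tH by simp
    ultimately have "f ` U = V" by (auto simp flip: im)
    then show "openin S (f ` U)" using V(1) by simp
  qed
  then show ?thesis
    using cont inj im by (simp add: bijective_open_imp_homeomorphic_map tG tH)
qed

lemma minimal_groupI_iso:
  fixes G :: "('a, 'c) monoid_scheme"
  assumes G: "topological_group G T"
    and *: "\<And>(H :: ('a, 'c) monoid_scheme) S f. topological_group H S \<Longrightarrow> f \<in> iso G H \<Longrightarrow>
              continuous_map T S f \<Longrightarrow> homeomorphic_map T S f"
  shows "minimal_group G T"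
  unfolding minimal_group_def
proof (intro conjI allI impI G)
  fix T' assume T': "topological_group G T' \<and> (\<forall>U. openin T' U \<longrightarrow> openin T U)"
  have tops: "topspace T' = topspace T" using G T' by (auto simp: topological_group_def)
  have "continuous_map T T' id"
    unfolding continuous_map_def
  proof (intro conjI allI impI)
    show "id \<in> topspace T \<rightarrow> topspace T'" by (simp add: tops)
    fix U assume U: "openin T' U"
    then have "{x \<in> topspace T. id x \<in> U} = U" using openin_subset[OF U] tops by auto
    then show "openin T {x \<in> topspace T. id x \<in> U}" using T' U by simp
  qed
  moreover have "id \<in> iso G G" by (auto simp: iso_def hom_def)
  ultimately have "homeomorphic_map T T' id" using * T' by blast
  then have "open_map T T' id" by (rule homeomorphic_imp_open_map)
  then show "T' = T" using T' by (auto simp: topology_eq open_map_def)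
qed

definition quotient_group_topology ::
  "('a, 'b) monoid_scheme \<Rightarrow> 'a topology \<Rightarrow> 'a set \<Rightarrow> 'a set topology" where
  "quotient_group_topology G T N =
     topology (\<lambda>U. U \<subseteq> carrier (G Mod N) \<and> openin T {x \<in> topspace T. N #>\<^bsub>G\<^esub> x \<in> U})"

lemma openin_quotient_group_topology:
  "openin (quotient_group_topology G T N) U \<longleftrightarrow>
     U \<subseteq> carrier (G Mod N) \<and> openin T {x \<in> topspace T. N #>\<^bsub>G\<^esub> x \<in> U}"
proof -
  let ?P = "\<lambda>U. {x \<in> topspace T. N #>\<^bsub>G\<^esub> x \<in> U}"
  have "istopology (\<lambda>U. U \<subseteq> carrier (G Mod N) \<and> openin T (?P U))"
    unfolding istopology_def
  proof (intro conjI allI impI)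
    fix A B assume "A \<subseteq> carrier (G Mod N) \<and> openin T (?P A)" "B \<subseteq> carrier (G Mod N) \<and> openin T (?P B)"
    moreover have "?P (A \<inter> B) = ?P A \<inter> ?P B" by auto
    ultimately show "A \<inter> B \<subseteq> carrier (G Mod N)" "openin T (?P (A \<inter> B))" by auto
  next
    fix K assume K: "\<forall>A\<in>K. A \<subseteq> carrier (G Mod N) \<and> openin T (?P A)"
    have "?P (\<Union>K) = \<Union> (?P ` K)" by auto
    moreover have "openin T (\<Union> (?P ` K))" using K by (intro openin_Union) auto
    ultimately show "openin T (?P (\<Union>K))" by simp
    show "\<Union>K \<subseteq> carrier (G Mod N)" using K by blast
  qed
  then show ?thesis by (simp add: quotient_group_topology_def)
qed

lemma quotient_map_quotient_group_topology:
  assumes "topspace T = carrier G"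
  shows "quotient_map T (quotient_group_topology G T N) (\<lambda>x. N #>\<^bsub>G\<^esub> x)"
proof -
  have c: "carrier (G Mod N) = (\<lambda>x. N #>\<^bsub>G\<^esub> x) ` topspace T"
    by (auto simp: FactGroup_def RCOSETS_def assms)
  moreover have "{x \<in> topspace T. N #>\<^bsub>G\<^esub> x \<in> carrier (G Mod N)} = topspace T"
    by (auto simp: c)
  then have "openin (quotient_group_topology G T N) (carrier (G Mod N))"
    by (simp add: openin_quotient_group_topology)
  then have "topspace (quotient_group_topology G T N) = carrier (G Mod N)"
    by (metis openin_quotient_group_topology openin_subset openin_topspace subset_antisym)
  ultimately show ?thesis
    by (auto simp: quotient_map_def openin_quotient_group_topology)
qed

definition totally_minimal_group :: "('a, 'b) monoid_scheme \<Rightarrow> 'a topology \<Rightarrow> bool" where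
  "totally_minimal_group G T \<longleftrightarrow>
     topological_group G T \<and>
     (\<forall>N. N \<lhd> G \<and> closedin T N \<longrightarrow> minimal_group (G Mod N) (quotient_group_topology G T N))"

section \<open>Special linear groups and roots of unity\<close>

text \<open>The degree is the cardinality of the index type \<open>'n\<close>.\<close>

definition SL :: "complex set \<Rightarrow> (complex ^ 'n ^ 'n) monoid" where
  "SL F = \<lparr>carrier = {A. (\<forall>i j. A $ i $ j \<in> F) \<and> det A = 1}, mult = (**), one = mat 1\<rparr>"

definition SL_topology :: "complex set \<Rightarrow> (complex ^ 'n ^ 'n) topology" where
  "SL_topology F = subtopology euclidean (carrier (SL F))"

definition rho :: "nat \<Rightarrow> complex" where
  "rho m = exp (2 * of_real pi * \<i> / of_nat m)"

definition rho_group :: "nat \<Rightarrow> complex set" where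
  "rho_group m = range (\<lambda>k :: int. rho m powi k)"

end

theory Submission
  imports Defs
begin

text \<open>Minimality of a group says that its continuous isomorphisms onto Hausdorff groups are open maps,
and total minimality that all its continuous surjective homomorphisms onto Hausdorff groups are.
So let \<open>f\<close> map \<open>SL(n,F)\<close> continuously onto a Hausdorff group \<open>H\<close>; when is \<open>f\<close> open?

Since \<open>F\<close> is dense in the complex numbers, \<open>SL(n,F)\<close> is dense in \<open>SL(n,\<complex>)\<close>. The closures in
\<open>SL(n,\<complex>)\<close> of the sets \<open>f -` U\<close>, for \<open>U\<close> a neighbourhood of \<open>1\<close>, generate a filter \<open>\<Phi>\<close> that behaves
like the neighbourhood filter of \<open>1\<close> for a group topology coarser than the usual one. The
intersection of its members, the core, is a closed normal subgroup of \<open>SL(n,\<complex>)\<close>, and \<open>f\<close> is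
trivial on those of its elements that lie in \<open>SL(n,F)\<close>. There are two cases.

If \<open>\<Phi>\<close> has no bounded member, let \<open>g\<close> tend to infinity along \<open>\<Phi>\<close>, such that \<open>g / \<parallel>g\<parallel>\<close> has a limit
\<open>g\<^sub>0\<close>. This limit is nonzero and singular. A rank one perturbation \<open>h\<close> of the identity can be chosen
such that \<open>h\<close> tends to \<open>1\<close> while \<open>g h g\<^sup>-\<^sup>1\<close> tends to a nontrivial transvection. In the coarse
topology \<open>g\<close> and \<open>h\<close> both tend to \<open>1\<close>, so this transvection lies in the core. One gets a whole line of
transvections, hence by conjugation all of them, and these generate \<open>SL(n,\<complex>)\<close>. So \<open>f\<close> is trivial, and
open for that reason (\<open>unbounded_imp_core_everything\<close>).

If \<open>\<Phi>\<close> has a bounded member, the core is a bounded normal subgroup, so it consists of scalars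
\<open>c\<close> with \<open>c\<^sup>n = 1\<close>, and by compactness \<open>\<Phi>\<close> is finer than the filter of neighbourhoods of the core. If all these
scalars lie in \<open>F\<close>, then \<open>f\<close> is open (\<open>open_map_if_scalar_core_subset\<close>).

This gives both sufficient conditions. If \<open>\<rho>\<^sub>n \<in> F\<close>, all \<open>n\<close>-th roots of unity lie in \<open>F\<close>. If \<open>f\<close> is
injective, the scalars of the core form a group of roots of unity that meets \<open>F\<close> only in \<open>1\<close>; if it
were nontrivial, it would contain \<open>\<langle>\<rho>\<^sub>m\<rangle>\<close> for some \<open>m > 1\<close> dividing \<open>n\<close>.

For the converse let \<open>M\<close> be a group of \<open>n\<close>-th roots of unity, and map \<open>SL(n,F)\<close> onto its image in the
Hausdorff group \<open>SL(n,\<complex>) / M\<close>. For \<open>c \<in> M\<close>, matrices in \<open>SL(n,F)\<close> near the scalar \<open>c\<close> have images near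
\<open>1\<close>; if the map is open, they are therefore multiples, by elements of \<open>M \<inter> F\<close>, of matrices near the
identity, and \<open>c\<close> itself must lie in \<open>F\<close> (\<open>open_map_imp_M_subset\<close>). Total minimality makes the map
open for \<open>M = \<langle>\<rho>\<^sub>n\<rangle>\<close>, and minimality does so for \<open>M = \<langle>\<rho>\<^sub>m\<rangle>\<close> whenever \<open>M \<inter> F = {1}\<close>.\<close>

no_notation fps_nth (infixl "$" 75)

section \<open>Transvections\<close>

text \<open>The bilinear pairing of \<open>\<complex>\<^sup>n\<close> with its dual, without complex conjugation; \<open>y\<close> stands for a row vector.\<close>

definition pairing :: "complex ^ 'n \<Rightarrow> complex ^ 'n \<Rightarrow> complex" where
  "pairing y x = (\<Sum>i\<in>UNIV. y $ i * x $ i)"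

text \<open>This is the identity plus the rank one matrix \<open>x y\<^sup>T\<close>. It is a transvection in the usual sense if
\<open>pairing y x = 0\<close>; without this condition the formula is still convenient for computing.\<close>

definition transvection :: "complex ^ 'n \<Rightarrow> complex ^ 'n \<Rightarrow> complex ^ 'n ^ 'n" where
  "transvection x y = (\<chi> i j. (if i = j then 1 else 0) + x $ i * y $ j)"

lemma axis_nth_if: "axis k c $ i = (if i = k then c else 0)"
  by (simp add: axis_def)

lemma pairing_add_left: "pairing (x + y) z = pairing x z + pairing y z"
  by (simp add: pairing_def distrib_right sum.distrib)

lemma pairing_add_right: "pairing z (x + y) = pairing z x + pairing z y"
  by (simp add: pairing_def distrib_left sum.distrib)

lemma pairing_diff_left: "pairing (x - y) z = pairing x z - pairing y z"
  by (simp add: pairing_def left_diff_distrib sum_subtractf)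

lemma pairing_diff_right: "pairing z (x - y) = pairing z x - pairing z y"
  by (simp add: pairing_def right_diff_distrib sum_subtractf)

lemma pairing_uminus_right: "pairing y (- x) = - pairing y x"
  by (simp add: pairing_def sum_negf)

lemma pairing_commute: "pairing y x = pairing x y"
  by (simp add: pairing_def mult.commute)

lemma pairing_smult_left: "pairing (c *s x) z = c * pairing x z"
  by (simp add: pairing_def sum_distrib_left mult_ac)

lemma pairing_smult_right: "pairing z (c *s x) = c * pairing z x"
  by (simp add: pairing_def sum_distrib_left mult_ac)

lemma pairing_axis_left: "pairing (axis k c) x = c * x $ k"
  by (simp add: pairing_def axis_def if_distrib[of "\<lambda>t. t * _"] cong: if_cong)

lemma pairing_axis_right: "pairing y (axis k c) = y $ k * c"
  by (simp add: pairing_def axis_def if_distrib[of "\<lambda>t. _ * t"] cong: if_cong)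

lemmas pairing_simps = pairing_add_left pairing_add_right pairing_diff_left pairing_diff_right
  pairing_smult_left pairing_smult_right pairing_axis_left pairing_axis_right

lemma pairing_matrix: "pairing y (A *v x) = pairing (y v* A) x"
  by (simp add: pairing_def matrix_vector_mult_def vector_matrix_mult_def
      sum_distrib_left sum_distrib_right mult_ac) (subst sum.swap, rule refl)

lemma pairing_column: "pairing y (column j A) = (y v* A) $ j"
  by (simp add: pairing_def column_def vector_matrix_mult_def mult_ac)

lemma transvection_mult_nth:
  "(transvection x y ** A) $ i $ j = A $ i $ j + x $ i * (y v* A) $ j"
  by (simp add: transvection_def matrix_matrix_mult_def vector_matrix_mult_def distrib_left
      sum.distrib sum_distrib_left mult_ac if_distrib[of "\<lambda>t. _ * t"] cong: if_cong)

lemma mult_transvection_nth: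
  "(A ** transvection x y) $ i $ j = A $ i $ j + (A *v x) $ i * y $ j"
  by (simp add: transvection_def matrix_matrix_mult_def matrix_vector_mult_def distrib_left
      sum.distrib sum_distrib_left mult_ac if_distrib[of "\<lambda>t. _ * t"] cong: if_cong)

lemma transvection_vector_mult: "transvection x y *v v = v + pairing y v *s x"
  by (simp add: transvection_def pairing_def matrix_vector_mult_def vec_eq_iff distrib_left distrib_right
      sum.distrib sum_distrib_left mult_ac if_distrib[of "\<lambda>t. _ * t"] cong: if_cong)

lemma vector_mult_transvection: "v v* transvection x y = v + pairing v x *s y"
  by (simp add: transvection_def pairing_def vector_matrix_mult_def vec_eq_iff distrib_right distrib_left
      sum.distrib sum_distrib_left mult_ac if_distrib[of "\<lambda>t. _ * t"] cong: if_cong)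

lemma transvection_zero [simp]: "transvection 0 y = mat 1" "transvection x 0 = mat 1"
  by (simp_all add: transvection_def mat_def vec_eq_iff)

lemma transvection_smult: "transvection (c *s x) y = transvection x (c *s y)"
  by (simp add: transvection_def mult_ac)

lemma transvection_mult_transvection:
  assumes "pairing y x' = 0"
  shows "transvection x y ** transvection x' y = transvection (x + x') y"
proof -
  have "(y v* transvection x' y) = y"
    using assms by (simp add: vector_mult_transvection)
  then show ?thesis
    by (simp add: vec_eq_iff transvection_mult_nth) (simp add: transvection_def distrib_right)
qed

lemma transvection_inverse:
  assumes "pairing y x = 0"
  shows "transvection (- x) y ** transvection x y = mat 1"
    and "transvection x y ** transvection (- x) y = mat 1"
proof -
  have "pairing y (- x) = 0"
    using assms by (simp add: pairing_uminus_right)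
  then show "transvection (- x) y ** transvection x y = mat 1"
    and "transvection x y ** transvection (- x) y = mat 1"
    using assms by (simp_all add: transvection_mult_transvection)
qed

lemma transvection_conjugate:
  fixes A B :: "complex ^ 'n ^ 'n"
  assumes "A ** B = mat 1"
  shows "A ** transvection x y ** B = transvection (A *v x) (y v* B)"
proof -
  have "A ** transvection x y = transvection (A *v x) (y v* B) ** A"
  proof -
    have "(y v* B) v* A = y"
      using assms matrix_left_right_inverse[of A B] by (simp add: vector_matrix_mul_assoc)
    then show ?thesis
      by (simp add: vec_eq_iff transvection_mult_nth mult_transvection_nth)
  qed
  then show ?thesis
    using assms by (simp add: matrix_mul_assoc[symmetric])
qed

lemma det_identity_column:
  fixes v :: "complex ^ 'n"
  shows "det (\<chi> i j. if j = k then v $ i else if i = j then 1 else 0) = v $ k"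
proof -
  have "(\<chi> i j. if j = k then v $ i else if i = j then 1 else 0)
      = (\<chi> i j. if j = k then (mat 1 *v v) $ i else mat 1 $ i $ j)"
    by (simp only: matrix_vector_mul_lid) (auto simp: mat_def vec_eq_iff)
  then show ?thesis
    using cramer_lemma[of k "mat 1" v] by simp
qed

lemma transvection_axis_column:
  "transvection v (axis k 1) = (\<chi> i j. if j = k then (axis k 1 + v) $ i else if i = j then 1 else 0)"
  by (auto simp: transvection_def vec_eq_iff axis_def)

text \<open>With \<open>g\<close> mapping a basis vector to \<open>x\<close>, the matrix \<open>g\<^sup>-\<^sup>1 (1 + x y\<^sup>T) g\<close> differs from the
identity in a single row, and off the diagonal.\<close>

lemma det_transvection:
  assumes "pairing y x = 0"
  shows "det (transvection x y) = 1"
proof (cases "x = 0")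
  case False
  then obtain j where j: "x $ j \<noteq> 0" by (auto simp: vec_eq_iff)
  define g where "g = transvection (x - axis j 1) (axis j 1)"
  have det_g: "det g = x $ j"
    by (simp add: g_def transvection_axis_column det_identity_column)
  have gj: "g *v axis j 1 = x"
    by (simp add: g_def transvection_vector_mult pairing_simps)
  define w where "w = y v* g"
  have w: "w $ j = 0"
    using assms gj pairing_matrix[of y g "axis j 1"] by (simp add: w_def pairing_simps)
  have "g ** transvection (axis j 1) w = transvection x y ** g"
    by (simp add: vec_eq_iff transvection_mult_nth mult_transvection_nth gj w_def)
  then have "det g * det (transvection (axis j 1) w) = det (transvection x y) * det g"
    by (metis det_mul)
  moreover have "transpose (transvection (axis j 1) w) = transvection w (axis j 1)"
    by (simp add: vec_eq_iff transpose_def transvection_def)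
  then have "det (transvection (axis j 1) w) = 1"
    using w by (metis (no_types) det_transpose transvection_axis_column det_identity_column
        vector_add_component axis_nth add.right_neutral)
  ultimately show ?thesis using j det_g by simp
qed simp

lemma det_one_mult_nonzero:
  fixes A :: "complex ^ 'n ^ 'n"
  assumes "det A = 1" "x \<noteq> 0"
  shows "A *v x \<noteq> 0"
  using assms invertible_det_nz[of A] by (metis invertible_def matrix_left_invertible_ker zero_neq_one)

text \<open>Gaussian elimination: multiplication by transvections on the left turns the columns of \<open>A\<close> one after
the other into the standard basis vectors. In a step with finished columns \<open>S\<close> and next column
\<open>v\<close> of index \<open>k\<close>, the matrix \<open>1 + (e\<^sub>k - v) y\<^sup>T\<close> maps \<open>v\<close> to \<open>e\<^sub>k\<close> if \<open>y\<close> takes the value \<open>1\<close> on both,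
and it preserves the finished columns if \<open>y\<close> vanishes on them. Such \<open>y\<close> is easily found if \<open>v\<close> has a nonzero
entry at another index outside \<open>S\<close>. If there is none, then \<open>v\<^sub>k \<noteq> 0\<close>, and either such an entry can be
created first, or \<open>k\<close> is the last index and the determinant forces \<open>v\<^sub>k = 1\<close>.\<close>

theorem transvections_generate:
  fixes A :: "complex ^ 'n ^ 'n"
  assumes mult: "\<And>A B. A \<in> P \<Longrightarrow> B \<in> P \<Longrightarrow> A ** B \<in> P"
    and transv: "\<And>x y. pairing y x = 0 \<Longrightarrow> transvection x y \<in> P"
    and "det A = 1"
  shows "A \<in> P"
proof -
  have cancel: "A \<in> P" if "pairing y x = 0" "transvection x y ** A \<in> P" for x y and A :: "complex ^ 'n ^ 'n"
  proof -
    have "pairing y (- x) = 0" using that(1) by (simp add: pairing_uminus_right)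
    then have "transvection (- x) y ** (transvection x y ** A) \<in> P"
      using that mult transv by blast
    then show ?thesis
      using that(1) by (simp add: matrix_mul_assoc transvection_inverse)
  qed
  have "A \<in> P" if "\<And>j i. j \<in> S \<Longrightarrow> A $ i $ j = (if i = j then 1 else 0)" "det A = 1" for S A
    using that
  proof (induction "card (- S)" arbitrary: S A)
    case 0
    then have "S = UNIV" by (auto simp: card_eq_0_iff)
    then have "A = transvection 0 0"
      using 0 by (simp add: vec_eq_iff transvection_def)
    then show ?case using transv[of 0 0] by (simp add: pairing_def)
  next
    case (Suc d)
    have "- S \<noteq> {}" using Suc(2) by auto
    then obtain k where k: "k \<notin> S" by auto
    have d: "d = card (- insert k S)"
      using Suc(2) k by (metis Compl_insert ComplI card_Diff_singleton diff_Suc_1)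
    \<comment> \<open>the elimination step for a row vector with the two required values\<close>
    have clear: "B \<in> P" if B: "\<And>j i. j \<in> S \<Longrightarrow> B $ i $ j = (if i = j then 1 else 0)" "det B = 1"
      and y: "\<And>j. j \<in> S \<Longrightarrow> y $ j = 0" "y $ k = 1" "pairing y (column k B) = 1" for B y
    proof -
      let ?x = "axis k 1 - column k B"
      have p: "pairing y ?x = 0" using y by (simp add: pairing_simps)
      have yB: "(y v* B) $ j = 0" if "j \<in> S" for j
      proof -
        have "(y v* B) $ j = (\<Sum>i\<in>UNIV. y $ i * (if i = j then 1 else 0))"
          using B(1) that by (simp add: vector_matrix_mult_def)
        then show ?thesis using y(1)[OF that] by (simp add: if_distrib[of "\<lambda>t. _ * t"] cong: if_cong)
      qed
      have yBk: "(y v* B) $ k = 1" using y(3) by (simp add: pairing_column)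
      have "transvection ?x y ** B \<in> P"
      proof (rule Suc.hyps(1)[OF d])
        show "det (transvection ?x y ** B) = 1" by (simp add: det_mul det_transvection[OF p] B(2))
        show "(transvection ?x y ** B) $ i $ j = (if i = j then 1 else 0)" if "j \<in> insert k S" for i j
        proof (cases "j = k")
          case True
          then show ?thesis by (simp add: transvection_mult_nth yBk column_def axis_def)
        next
          case False
          then show ?thesis using that B(1) by (simp add: transvection_mult_nth yB)
        qed
      qed
      then show ?thesis using cancel[OF p] by blast
    qed
    \<comment> \<open>a nonzero entry of the column outside the finished part and the pivot position provides such a row vector\<close>
    have clear': "B \<in> P" if B: "\<And>j i. j \<in> S \<Longrightarrow> B $ i $ j = (if i = j then 1 else 0)" "det B = 1"
      and l: "l \<notin> S" "l \<noteq> k" "B $ l $ k \<noteq> 0" for B l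
    proof (rule clear[OF B])
      let ?y = "axis k 1 + axis l ((1 - B $ k $ k) / B $ l $ k)"
      show "?y $ k = 1" using l by (simp add: axis_def)
      show "?y $ j = 0" if "j \<in> S" for j using l k that by (auto simp: axis_def)
      show "pairing ?y (column k B) = 1" using l by (simp add: pairing_simps column_def)
    qed
    show ?case
    proof (cases "\<exists>l. l \<notin> S \<and> l \<noteq> k \<and> A $ l $ k \<noteq> 0")
      case True
      then show ?thesis using clear' Suc.prems by blast
    next
      case False
      then have z: "A $ l $ k = 0" if "l \<notin> S" "l \<noteq> k" for l using that by blast
      \<comment> \<open>otherwise column \<open>k\<close> would be a combination of the finished columns\<close>
      have Akk: "A $ k $ k \<noteq> 0"
      proof
        assume Akk: "A $ k $ k = 0"
        define v where "v = (\<chi> j. if j = k then 1 else if j \<in> S then - A $ j $ k else 0)"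
        have "(A *v v) $ i = 0" for i
        proof -
          have "(A *v v) $ i = (\<Sum>j\<in>UNIV. (if j = k then A $ i $ k else 0) -
              (if i = j then if j \<in> S then A $ j $ k else 0 else 0))"
            unfolding matrix_vector_mult_def vec_lambda_beta v_def
            by (rule sum.cong) (use k Suc.prems(1) in auto)
          also have "\<dots> = A $ i $ k - (if i \<in> S then A $ i $ k else 0)"
            by (simp add: sum_subtractf)
          finally show ?thesis using z Akk by (cases "i = k") auto
        qed
        then have "A *v v = 0" by (simp add: vec_eq_iff)
        moreover have "v \<noteq> 0" by (auto simp: vec_eq_iff v_def intro!: exI[of _ k])
        ultimately show False using det_one_mult_nonzero Suc.prems(2) by blast
      qed
      show ?thesis
      proof (cases "\<exists>l. l \<notin> S \<and> l \<noteq> k")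
        case True
        then obtain l where l: "l \<notin> S" "l \<noteq> k" by blast
        \<comment> \<open>adding row \<open>k\<close>, divided by the pivot, to row \<open>l\<close> makes the \<open>l\<close>-th entry of the column equal to \<open>1\<close>\<close>
        let ?y = "axis k (1 / A $ k $ k)" and ?x = "axis l 1 :: complex ^ 'n"
        have p: "pairing ?y ?x = 0" using l by (simp add: pairing_simps axis_nth_if)
        have y: "(?y v* A) $ j = A $ k $ j / A $ k $ k" for j
          by (simp add: vector_matrix_mult_def axis_def if_distrib[of "\<lambda>t. _ * t"]
              if_distrib[of "\<lambda>t. t * _"] cong: if_cong)
        have "transvection ?x ?y ** A \<in> P"
        proof (rule clear')
          show "det (transvection ?x ?y ** A) = 1"
            by (simp add: det_mul det_transvection[OF p] Suc.prems(2))
          show "(transvection ?x ?y ** A) $ l $ k \<noteq> 0"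
            using Akk l z by (simp add: transvection_mult_nth y)
          show "(transvection ?x ?y ** A) $ i $ j = (if i = j then 1 else 0)" if "j \<in> S" for i j
            using that k Suc.prems(1) by (auto simp: transvection_mult_nth y)
        qed (use l in auto)
        then show ?thesis using cancel[OF p] by blast
      next
        case False
        then have "j \<in> S" if "j \<noteq> k" for j using that by blast
        then have "A $ i $ j = (if j = k then column k A $ i else if i = j then 1 else 0)" for i j
          using Suc.prems(1)[of j i] by (auto simp: column_def)
        then have "A = (\<chi> i j. if j = k then column k A $ i else if i = j then 1 else 0)"
          unfolding vec_eq_iff vec_lambda_beta by blast
        from arg_cong[OF this, of det] have "det A = column k A $ k"
          unfolding det_identity_column .
        then have "A $ k $ k = 1" using Suc.prems(2) by (simp add: column_def)
        then show ?thesis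
          by (intro clear[of A "axis k 1"]) (use Suc.prems k in \<open>auto simp: pairing_simps column_def axis_nth_if\<close>)
      qed
    qed
  qed
  from this[of "{}"] show ?thesis using assms(3) by simp
qed

section \<open>Scalar matrices\<close>

lemma det_mat: "det (mat c :: complex ^ 'n ^ 'n) = c ^ CARD('n)"
  by (subst det_diagonal) (simp_all add: mat_def)

lemma mat_mult_nth: "(mat c ** A) $ i $ j = c * A $ i $ j"
  by (simp add: mat_def matrix_matrix_mult_def if_distrib[of "\<lambda>t. t * _"] cong: if_cong)

lemma mult_mat_nth: "(A ** mat c) $ i $ j = c * (A $ i $ j :: complex)"
  by (simp add: mat_def matrix_matrix_mult_def if_distrib[of "\<lambda>t. _ * t"] mult.commute cong: if_cong)

lemma mat_mult_mat: "mat a ** mat b = (mat (a * b) :: complex ^ 'n ^ 'n)"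
  by (simp add: vec_eq_iff mat_mult_nth) (simp add: mat_def)

lemma mat_commute: "mat c ** A = A ** (mat c :: complex ^ 'n ^ 'n)"
  by (simp add: vec_eq_iff mat_mult_nth mult_mat_nth)

lemma mat_inject: "mat a = (mat b :: complex ^ 'n ^ 'n) \<longleftrightarrow> a = b"
proof
  fix i :: 'n
  assume "mat a = (mat b :: complex ^ 'n ^ 'n)"
  then have "(mat a :: complex ^ 'n ^ 'n) $ i $ i = (mat b :: complex ^ 'n ^ 'n) $ i $ i" by simp
  then show "a = b" by (simp add: mat_def)
qed simp

section \<open>Normal subgroups of the special linear group\<close>

lemma ex_pairing_nonzero:
  assumes "x \<noteq> 0" "x' \<noteq> 0"
  shows "\<exists>q. pairing q x \<noteq> 0 \<and> pairing q x' \<noteq> 0"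
proof -
  obtain a b where a: "x $ a \<noteq> 0" and b: "x' $ b \<noteq> 0"
    using assms by (auto simp: vec_eq_iff)
  have "pairing (axis a 1) x \<noteq> 0" "pairing (axis b 1) x' \<noteq> 0"
    using a b by (simp_all add: pairing_simps)
  then show ?thesis
    by (cases "pairing (axis a 1) x' = 0"; cases "pairing (axis b 1) x = 0")
      (auto simp: pairing_add_left intro: exI[of _ "axis a 1"] exI[of _ "axis b 1"]
        exI[of _ "axis a 1 + axis b 1"])
qed

text \<open>Two conjugations suffice: a transvection \<open>T\<close> moves \<open>x\<close> to a multiple of \<open>x'\<close>, and another one, fixing \<open>x'\<close>, moves the resulting row vector to
\<open>y'\<close> after rescaling. Scalar factors are harmless because a full line \<open>{1 + c x y\<^sup>T}\<close> is given.\<close>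

lemma transvections_conjugate_line:
  fixes N :: "(complex ^ 'n ^ 'n) set"
  assumes conj: "\<And>A B u. det A = 1 \<Longrightarrow> A ** B = mat 1 \<Longrightarrow> u \<in> N \<Longrightarrow> A ** u ** B \<in> N"
    and line: "\<And>c. transvection (c *s x) y \<in> N"
    and nz: "x \<noteq> 0" "y \<noteq> 0" and "pairing y x = 0" and orth: "pairing y' x' = 0"
  shows "transvection x' y' \<in> N"
proof (cases "x' = 0 \<or> y' = 0")
  case True
  then show ?thesis using line[of 0] by auto
next
  case False
  then obtain q where q: "pairing q x \<noteq> 0" "pairing q x' \<noteq> 0"
    using ex_pairing_nonzero nz(1) by metis
  define c where "c = pairing q x / pairing q x'"
  define p where "p = (1 / pairing q x) *s (c *s x' - x)"
  define T where "T = transvection p q"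
  define T' where "T' = transvection (- p) q"
  have c: "c \<noteq> 0" using q by (simp add: c_def)
  have qp: "pairing q p = 0" using q by (simp add: p_def pairing_simps c_def)
  have TT: "det T = 1" "T ** T' = mat 1" "T' ** T = mat 1"
    using qp by (simp_all add: T_def T'_def det_transvection transvection_inverse)
  have Tx: "T *v x = c *s x'"
    using q(1) by (simp add: T_def transvection_vector_mult p_def vec_eq_iff)
  define y1 where "y1 = y v* T'"
  have y1T: "y1 v* T = y" using TT by (simp add: y1_def vector_matrix_mul_assoc)
  then have y1: "y1 \<noteq> 0" using nz(2) by auto
  have "c * pairing y1 x' = 0"
    using \<open>pairing y x = 0\<close> pairing_matrix[of y1 T x] y1T Tx by (simp add: pairing_simps)
  then have orth1: "pairing y1 x' = 0" using c by simp
  have line1: "transvection (d *s x') y1 \<in> N" for d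
  proof -
    have "T ** transvection ((d / c) *s x) y ** T' \<in> N"
      using conj TT line by blast
    moreover have "T *v ((d / c) *s x) = d *s x'"
      using Tx c by (simp add: matrix_vector_mult_scaleR vec.scale)
    ultimately show ?thesis
      using transvection_conjugate[OF TT(2)] by (simp add: y1_def)
  qed
  \<comment> \<open>\<open>r\<close> pairs nontrivially with both row vectors, so that \<open>y1\<close> can be scaled to agree with \<open>y'\<close> on \<open>r\<close>\<close>
  obtain r where r: "pairing r y' \<noteq> 0" "pairing r y1 \<noteq> 0"
    using ex_pairing_nonzero y1 False by metis
  define y2 where "y2 = (pairing r y' / pairing r y1) *s y1"
  have y2: "transvection x' y2 \<in> N"
    using line1 by (simp add: y2_def transvection_smult[symmetric])
  have ry2: "pairing r y2 = pairing r y'" using r by (simp add: y2_def pairing_simps)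
  have orth2: "pairing y2 x' = 0" by (simp add: y2_def pairing_simps orth1)
  define s where "s = (1 / pairing r y') *s (y2 - y')"
  define U where "U = transvection r s"
  define U' where "U' = transvection (- r) s"
  have sr: "pairing s r = 0"
    using ry2 by (simp add: s_def pairing_simps pairing_commute[of _ r])
  have UU: "det U = 1" "U ** U' = mat 1"
    using sr by (simp_all add: U_def U'_def det_transvection transvection_inverse)
  have "U *v x' = x'"
    using orth orth2 by (simp add: U_def transvection_vector_mult s_def pairing_simps)
  moreover have "y2 v* U' = y'"
    using r ry2 by (simp add: U'_def vector_mult_transvection pairing_uminus_right
        pairing_commute[of _ r] s_def vec_eq_iff)
  ultimately show ?thesis
    using conj[OF UU y2] by (simp add: transvection_conjugate[OF UU(2)])
qed

lemma bounded_affine_imp_constant: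
  fixes a b :: complex
  assumes "\<And>t. norm (a + t * b) \<le> R"
  shows "b = 0"
proof (rule ccontr)
  assume "b \<noteq> 0"
  then have "a + ((of_real (R + 1) - a) / b) * b = of_real (R + 1)" by simp
  then have "norm (of_real (R + 1) :: complex) \<le> R" using assms by metis
  then show False by simp
qed

lemma norm_entry_le: "norm (A $ i $ j) \<le> norm (A :: complex ^ 'n ^ 'm)"
  using Finite_Cartesian_Product.norm_nth_le[of "A $ i" j] Finite_Cartesian_Product.norm_nth_le[of A i]
  by linarith

text \<open>The entries of the conjugates of \<open>u\<close> by \<open>1 + t e\<^sub>i e\<^sub>j\<^sup>T\<close> are polynomials in \<open>t\<close>. If they stay bounded, their
nonconstant coefficients vanish, and among these are the off-diagonal entries of \<open>u\<close> and the differences of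
its diagonal entries.\<close>

lemma bounded_conjugates_imp_scalar:
  fixes u :: "complex ^ 'n ^ 'n"
  assumes bdd: "\<And>A B. det A = 1 \<Longrightarrow> A ** B = mat 1 \<Longrightarrow> norm (A ** u ** B) \<le> R"
  shows "\<exists>c. u = mat c"
proof -
  have entry: "norm ((transvection (axis i t) (axis j 1) ** u **
      transvection (- axis i t) (axis j 1)) $ a $ b) \<le> R" if "i \<noteq> j" for i j t a b
  proof -
    have "pairing (axis j 1) (axis i t) = 0" using that by (simp add: pairing_simps axis_nth_if)
    then have "norm (transvection (axis i t) (axis j 1) ** u ** transvection (- axis i t) (axis j 1)) \<le> R"
      by (intro bdd det_transvection transvection_inverse(2))
    then show ?thesis using norm_entry_le order_trans by blast
  qed
  have rowj: "(axis j 1 v* u) = u $ j" for j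
    by (simp add: vec_eq_iff vector_matrix_mult_def axis_def if_distrib[of "\<lambda>t. _ * t"]
        if_distrib[of "\<lambda>t. t * _"] cong: if_cong)
  have coli: "(A *v - axis i t) $ a = - t * A $ a $ i" for A :: "complex ^ 'n ^ 'n" and i a t
    by (simp add: matrix_vector_mult_def axis_def if_distrib[of "\<lambda>t. _ * t"] sum_negf mult.commute cong: if_cong)
  have off: "u $ j $ b = 0" if "j \<noteq> b" for j b
  proof (rule bounded_affine_imp_constant)
    fix t
    show "norm (u $ b $ b + t * u $ j $ b) \<le> R"
      using entry[of b j t b b] that by (simp add: mult_transvection_nth transvection_mult_nth rowj) (simp add: axis_nth_if)
  qed
  have diag: "u $ j $ j = u $ i $ i" for i j
  proof (cases "i = j")
    case False
    have "u $ j $ j - u $ i $ i = 0"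
    proof (rule bounded_affine_imp_constant)
      fix t
      have "(transvection (axis i t) (axis j 1) ** u ** transvection (- axis i t) (axis j 1)) $ i $ j
          = u $ i $ j + t * (u $ j $ j - u $ i $ i)"
        using False off[of j i]
        by (simp add: mult_transvection_nth transvection_mult_nth rowj coli algebra_simps)
      then show "norm (u $ i $ j + t * (u $ j $ j - u $ i $ i)) \<le> R"
        using entry[OF False] by metis
    qed
    then show ?thesis by simp
  qed simp
  have "u = mat (u $ i $ i)" for i
    using off diag by (auto simp: vec_eq_iff mat_def)
  then show ?thesis by blast
qed

section \<open>The topology of the special linear group\<close>

text \<open>Cramer's rule exhibits the inverse of a matrix of determinant one as a polynomial map.\<close>

definition adjugate :: "complex ^ 'n ^ 'n \<Rightarrow> complex ^ 'n ^ 'n" where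
  "adjugate A = (\<chi> k l. det (\<chi> i j. if j = k then (if i = l then 1 else 0) else A $ i $ j))"

lemma adjugate_right:
  assumes "det A = 1"
  shows "A ** adjugate A = mat 1"
proof -
  have adj: "adjugate A = (\<chi> k l. det (\<chi> i j. if j = k then axis l 1 $ i else A $ i $ j))"
    by (simp add: adjugate_def axis_nth_if cong: if_cong)
  have "A *v (\<chi> k. adjugate A $ k $ l) = axis l 1" for l
    using cramer[of A "\<chi> k. adjugate A $ k $ l" "axis l 1"] assms
    by (simp add: adj)
  then have "(A ** adjugate A) $ i $ l = axis l 1 $ i" for i l
    by (simp add: matrix_matrix_mult_def matrix_vector_mult_def vec_eq_iff)
  then show ?thesis by (simp add: vec_eq_iff mat_def axis_def)
qed

lemma adjugate_left: "det A = 1 \<Longrightarrow> adjugate A ** A = mat 1"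
  using adjugate_right matrix_left_right_inverse by blast

lemma det_adjugate: "det A = 1 \<Longrightarrow> det (adjugate A) = 1"
  using adjugate_right[of A] det_mul[of A "adjugate A"] by simp

lemma adjugate_unique: "det A = 1 \<Longrightarrow> A ** B = mat 1 \<Longrightarrow> B = adjugate A"
  by (metis adjugate_left matrix_mul_assoc matrix_mul_lid matrix_mul_rid)

lemma continuous_on_det [continuous_intros]:
  fixes f :: "'a::topological_space \<Rightarrow> complex ^ 'n ^ 'n"
  assumes "continuous_on S f"
  shows "continuous_on S (\<lambda>x. det (f x))"
  unfolding det_def by (intro continuous_intros assms)

lemma continuous_on_matrix_mult [continuous_intros]:
  fixes f :: "'a::topological_space \<Rightarrow> complex ^ 'm ^ 'n" and g :: "'a \<Rightarrow> complex ^ 'k ^ 'm"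
  assumes "continuous_on S f" "continuous_on S g"
  shows "continuous_on S (\<lambda>x. f x ** g x)"
  unfolding matrix_matrix_mult_def by (intro continuous_intros assms)

lemma continuous_on_adjugate [continuous_intros]:
  fixes f :: "'a::topological_space \<Rightarrow> complex ^ 'n ^ 'n"
  assumes "continuous_on S f"
  shows "continuous_on S (\<lambda>x. adjugate (f x))"
  unfolding adjugate_def
proof (intro continuous_intros)
  show "continuous_on S (\<lambda>x. if j = k then if i = l then 1 else 0 else f x $ i $ j)" for i j k l
    by (cases "j = k") (auto intro!: continuous_intros assms)
qed

lemma continuous_on_transvection [continuous_intros]:
  assumes "continuous_on S f" "continuous_on S g"
  shows "continuous_on S (\<lambda>x. transvection (f x) (g x))"
  unfolding transvection_def by (intro continuous_intros assms)

lemma continuous_on_vector_matrix_mult [continuous_intros]: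
  fixes f :: "'a::topological_space \<Rightarrow> complex ^ 'n"
  assumes "continuous_on S f" "continuous_on S g"
  shows "continuous_on S (\<lambda>x. f x v* g x)"
  unfolding vector_matrix_mult_def by (intro continuous_intros assms)

lemma continuous_on_vector_smult [continuous_intros]:
  fixes f :: "'a::topological_space \<Rightarrow> complex ^ 'n"
  assumes "continuous_on S c" "continuous_on S f"
  shows "continuous_on S (\<lambda>x. c x *s f x)"
  unfolding vector_scalar_mult_def by (intro continuous_intros assms)

lemma continuous_on_pairing [continuous_intros]:
  assumes "continuous_on S f" "continuous_on S g"
  shows "continuous_on S (\<lambda>x. pairing (f x) (g x))"
  unfolding pairing_def by (intro continuous_intros assms)

lemma continuous_on_column [continuous_intros]:
  fixes f :: "'a::topological_space \<Rightarrow> complex ^ 'n ^ 'm"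
  assumes "continuous_on S f"
  shows "continuous_on S (\<lambda>x. column j (f x))"
  unfolding column_def by (intro continuous_intros assms)

lemma closed_SL_UNIV: "closed {A :: complex ^ 'n ^ 'n. det A = 1}"
  by (intro closed_Collect_eq continuous_intros)

text \<open>Taking \<open>F = UNIV\<close> makes the facts of this locale available for \<open>SL(n,\<complex>)\<close> as well.\<close>

locale complex_subfield =
  fixes F :: "complex set"
  assumes zero_mem: "0 \<in> F" and one_mem: "1 \<in> F"
    and add_mem: "x \<in> F \<Longrightarrow> y \<in> F \<Longrightarrow> x + y \<in> F"
    and mult_mem: "x \<in> F \<Longrightarrow> y \<in> F \<Longrightarrow> x * y \<in> F"
    and uminus_mem: "x \<in> F \<Longrightarrow> - x \<in> F"
    and inverse_mem: "x \<in> F \<Longrightarrow> inverse x \<in> F"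
begin

lemma sum_mem: "(\<And>i. i \<in> I \<Longrightarrow> f i \<in> F) \<Longrightarrow> sum f I \<in> F"
  by (induction I rule: infinite_finite_induct) (auto simp: zero_mem add_mem)

lemma prod_mem: "(\<And>i. i \<in> I \<Longrightarrow> f i \<in> F) \<Longrightarrow> prod f I \<in> F"
  by (induction I rule: infinite_finite_induct) (auto simp: one_mem mult_mem)

lemma power_mem: "x \<in> F \<Longrightarrow> x ^ k \<in> F"
  by (induction k) (auto simp: one_mem mult_mem)

lemma det_mem: "(\<And>i j. A $ i $ j \<in> F) \<Longrightarrow> det A \<in> F"
  unfolding det_def sign_def
  by (auto intro!: sum_mem mult_mem prod_mem uminus_mem one_mem)

lemma adjugate_mem: "(\<And>i j. A $ i $ j \<in> F) \<Longrightarrow> adjugate A $ i $ j \<in> F"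
  unfolding adjugate_def by (auto intro!: det_mem simp: zero_mem one_mem)

lemma carrier_SL: "A \<in> carrier (SL F) \<longleftrightarrow> (\<forall>i j. A $ i $ j \<in> F) \<and> det A = 1"
  by (simp add: SL_def)

lemma mult_SL: "A \<otimes>\<^bsub>SL F\<^esub> B = A ** B"
  by (simp add: SL_def)

lemma one_SL: "\<one>\<^bsub>SL F\<^esub> = mat 1"
  by (simp add: SL_def)

lemma adjugate_SL: "A \<in> carrier (SL F) \<Longrightarrow> adjugate A \<in> carrier (SL F)"
  by (simp add: carrier_SL adjugate_mem det_adjugate)

lemma mult_mem_SL: "A \<in> carrier (SL F) \<Longrightarrow> B \<in> carrier (SL F) \<Longrightarrow> A ** B \<in> carrier (SL F)"
  by (auto simp: carrier_SL det_mul) (auto simp: matrix_matrix_mult_def intro!: sum_mem mult_mem)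

lemma group_SL: "Group.group (SL F :: (complex ^ 'n ^ 'n) monoid)"
proof (rule groupI)
  fix A :: "complex ^ 'n ^ 'n" assume "A \<in> carrier (SL F)"
  then show "\<exists>B\<in>carrier (SL F). B \<otimes>\<^bsub>SL F\<^esub> A = \<one>\<^bsub>SL F\<^esub>"
    by (intro bexI[of _ "adjugate A"]) (auto simp: adjugate_SL mult_SL one_SL adjugate_left carrier_SL[of A])
next
  show "\<one>\<^bsub>SL F\<^esub> \<in> carrier (SL F :: (complex ^ 'n ^ 'n) monoid)"
    by (simp add: one_SL carrier_SL mat_def[of 1, THEN arg_cong, of "\<lambda>A. A $ _ $ _"] zero_mem one_mem)
qed (simp_all add: mult_SL one_SL mult_mem_SL matrix_mul_assoc)

lemma inv_SL: "A \<in> carrier (SL F) \<Longrightarrow> inv\<^bsub>SL F\<^esub> A = adjugate A"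
  by (rule group.inv_equality[OF group_SL])
    (auto simp: adjugate_SL mult_SL one_SL adjugate_left carrier_SL[of A])

lemma topspace_SL: "topspace (SL_topology F) = carrier (SL F)"
  by (simp add: SL_topology_def)

lemma topological_group_SL: "topological_group (SL F :: (complex ^ 'n ^ 'n) monoid) (SL_topology F)"
  unfolding topological_group_def
proof (intro conjI)
  let ?G = "carrier (SL F :: (complex ^ 'n ^ 'n) monoid)"
  show "Hausdorff_space (SL_topology F :: (complex ^ 'n ^ 'n) topology)"
    by (simp add: SL_topology_def Hausdorff_space_subtopology)
  have "continuous_on (?G \<times> ?G) (\<lambda>(A, B). A ** B)"
    unfolding split_def by (intro continuous_intros)
  then show "continuous_map (prod_topology (SL_topology F) (SL_topology F)) (SL_topology F)
      (\<lambda>(A, B). A \<otimes>\<^bsub>SL F\<^esub> B :: complex ^ 'n ^ 'n)"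
    by (auto simp: SL_topology_def subtopology_Times[symmetric] euclidean_product_topology
        continuous_map_in_subtopology mult_SL mult_mem_SL)
  have "continuous_on ?G adjugate" by (intro continuous_intros)
  then have "continuous_map (SL_topology F) (SL_topology F) (adjugate :: complex ^ 'n ^ 'n \<Rightarrow> _)"
    by (auto simp: SL_topology_def continuous_map_in_subtopology adjugate_SL)
  then show "continuous_map (SL_topology F) (SL_topology F) (\<lambda>A :: complex ^ 'n ^ 'n. inv\<^bsub>SL F\<^esub> A)"
    by (rule continuous_map_eq) (simp add: inv_SL topspace_SL)
qed (auto simp: group_SL topspace_SL)

end

lemma complex_subfield_UNIV: "complex_subfield UNIV"
  by unfold_locales auto

lemma complex_subfield_subfield:
  assumes "subfield F (ring_of_type_algebra :: complex ring)"
  shows "complex_subfield F"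
proof -
  let ?R = "ring_of_type_algebra :: complex ring"
  interpret R: field ?R by (rule field_from_type_algebra)
  have sr: "subring F ?R"
    using assms by (meson subcring_def subdomain.axioms(1) subfield.axioms(1))
  note E = subringE[OF sr]
  have neg: "\<ominus>\<^bsub>?R\<^esub> x = - x" for x
    by (rule R.minus_equality) (auto simp: ring_of_type_algebra_def)
  have R: "x \<in> F \<Longrightarrow> y \<in> F \<Longrightarrow> x + y \<in> F" "x \<in> F \<Longrightarrow> y \<in> F \<Longrightarrow> x * y \<in> F" "0 \<in> F" "1 \<in> F"
    "x \<in> F \<Longrightarrow> - x \<in> F" for x y
    using E(2,3,5,6,7) neg by (auto simp: ring_of_type_algebra_def)
  moreover have "inverse x \<in> F" if "x \<in> F" for x
  proof (cases "x = 0")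
    case False
    then have "x \<in> Units (?R\<lparr>carrier := F\<rparr>)"
      using that subfield.subfield_Units[OF assms] by (simp add: ring_of_type_algebra_def)
    then obtain y where "y \<in> F" "y * x = 1" by (auto simp: Units_def ring_of_type_algebra_def)
    then show ?thesis using False by (metis inverse_unique mult.commute)
  qed (use R in simp)
  ultimately show ?thesis by unfold_locales auto
qed

lemma dense_vec:
  fixes D :: "'a::topological_space set"
  assumes "closure D = UNIV"
  shows "closure {v :: 'a ^ 'n. \<forall>i. v $ i \<in> D} = UNIV"
proof -
  have "{v :: 'a ^ 'n. \<forall>i. v $ i \<in> D} \<inter> S \<noteq> {}" if S: "open S" "x \<in> S" for S x
  proof -
    obtain U where U: "\<And>i. open (U i)" "\<And>i. x $ i \<in> U i" "\<And>y. (\<And>i. y $ i \<in> U i) \<Longrightarrow> y \<in> S"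
      using S unfolding open_vec_def by metis
    have "\<exists>d. d \<in> D \<inter> U i" for i
      using open_Int_closure_eq_empty[OF U(1), of i D] U(2)[of i] assms by auto
    then obtain d where d: "\<And>i. d i \<in> D \<inter> U i" by metis
    then have "(\<chi> i. d i) \<in> S" by (intro U(3)) auto
    then show ?thesis using d by (auto simp: disjoint_iff intro!: exI[of _ "\<chi> i. d i"])
  qed
  then show ?thesis
    unfolding set_eq_iff closure_iff_nhds_not_empty by blast
qed

lemma det_scale_row:
  fixes A :: "complex ^ 'n ^ 'n"
  shows "det (\<chi> i. if i = k then c *s A $ i else A $ i) = c * det A"
  using det_row_mul[of k c "\<lambda>i. A $ i" "\<lambda>i. A $ i"] by simp

locale dense_complex_subfield = complex_subfield +
  assumes dense: "closure F = UNIV"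
begin

text \<open>An approximation of \<open>A\<close> with entries in \<open>F\<close> has determinant close to \<open>1\<close>; dividing one row by the
determinant corrects it without leaving \<open>F\<close> or a neighbourhood of \<open>A\<close>.\<close>

lemma SL_dense:
  fixes A :: "complex ^ 'n ^ 'n"
  assumes "det A = 1" "open U" "A \<in> U"
  shows "\<exists>B\<in>U. B \<in> carrier (SL F)"
proof -
  fix k :: 'n
  define rescale :: "complex ^ 'n ^ 'n \<Rightarrow> complex ^ 'n ^ 'n" where
    "rescale = (\<lambda>Y. \<chi> i. if i = k then (1 / det Y) *s Y $ i else Y $ i)"
  have "closure {Y :: complex ^ 'n ^ 'n. \<forall>i j. Y $ i $ j \<in> F} = UNIV"
    using dense_vec[OF dense_vec[OF dense]] by simp
  moreover have "open {Y :: complex ^ 'n ^ 'n. det Y \<noteq> 0}"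
    by (intro open_Collect_neq continuous_intros)
  moreover have "continuous_on {Y. det Y \<noteq> 0} rescale"
    unfolding rescale_def
  proof (rule continuous_on_vec_lambda)
    show "continuous_on {Y. det Y \<noteq> 0} (\<lambda>Y. if i = k then (1 / det Y) *s Y $ i else Y $ i :: complex ^ 'n)" for i
    proof -
      have "continuous_on {Y. det Y \<noteq> 0} (\<lambda>Y. (1 / det Y) *s Y $ k :: complex ^ 'n)"
        unfolding vector_scalar_mult_def by (intro continuous_intros) auto
      moreover have "continuous_on {Y. det Y \<noteq> 0} (\<lambda>Y. Y $ i :: complex ^ 'n)"
        by (intro continuous_intros)
      ultimately show ?thesis by (cases "i = k") simp_all
    qed
  qed
  ultimately have "open (rescale -` U \<inter> {Y. det Y \<noteq> 0})"
    using assms(2) continuous_on_open_vimage by blast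
  moreover have "rescale A = A" using assms(1) by (simp add: rescale_def vec_eq_iff)
  then have "A \<in> rescale -` U \<inter> {Y. det Y \<noteq> 0}" using assms by simp
  ultimately obtain Y where Y: "rescale Y \<in> U" "det Y \<noteq> 0" "\<And>i j. Y $ i $ j \<in> F"
    using open_Int_closure_eq_empty[of "rescale -` U \<inter> {Y. det Y \<noteq> 0}" "{Y. \<forall>i j. Y $ i $ j \<in> F}"]
      \<open>closure {Y. \<forall>i j. Y $ i $ j \<in> F} = UNIV\<close> by auto
  have "det (rescale Y) = 1"
    using Y(2) by (simp add: rescale_def det_scale_row)
  moreover have "rescale Y $ i $ j \<in> F" for i j
    using Y(3) by (auto simp: rescale_def divide_inverse intro!: mult_mem inverse_mem det_mem)
  ultimately show ?thesis using Y(1) by (auto simp: carrier_SL)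
qed

end

section \<open>Group filters on the special linear group\<close>

text \<open>In this way a cluster point of \<open>f\<close> along \<open>F\<close> becomes a limit along a finer proper filter.\<close>

lemma inf_filtercomap_neq_bot:
  assumes "inf G (filtermap f F) \<noteq> bot"
  shows "inf F (filtercomap f G) \<noteq> bot"
proof
  assume "inf F (filtercomap f G) = bot"
  then have "eventually (\<lambda>_. False) (inf F (filtercomap f G))" by simp
  then obtain P Q where P: "eventually P F" and Q: "eventually Q (filtercomap f G)"
    and PQ: "\<And>x. P x \<Longrightarrow> Q x \<Longrightarrow> False"
    by (auto simp: eventually_inf)
  obtain R where R: "eventually R G" "\<And>x. R (f x) \<Longrightarrow> Q x"
    using Q by (auto simp: eventually_filtercomap)
  have "eventually (\<lambda>y. \<not> R y) (filtermap f F)"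
    using P by (auto simp: eventually_filtermap elim!: eventually_mono dest: PQ R(2))
  then have "eventually (\<lambda>_. False) (inf G (filtermap f F))"
    using R(1) by (auto simp: eventually_inf)
  then show False using assms by (simp add: eventually_False)
qed

text \<open>The neighbourhood filter of the identity for a group topology on \<open>SL(n,\<complex>)\<close> that is coarser than the
usual one and possibly not Hausdorff. Invariance under conjugation is demanded only for a dense set of
elements, which is what a topology on a dense subgroup provides.\<close>

locale group_filter =
  fixes \<Phi> :: "(complex ^ 'n ^ 'n) filter"
  assumes eventually_det: "eventually (\<lambda>A. det A = 1) \<Phi>"
    and coarser: "inf (nhds (mat 1)) (principal {A. det A = 1}) \<le> \<Phi>"
    and filterlim_mult: "filterlim (\<lambda>(A, B). A ** B) \<Phi> (\<Phi> \<times>\<^sub>F \<Phi>)"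
    and filterlim_adjugate: "filterlim adjugate \<Phi> \<Phi>"
    and filterlim_conj: "\<And>U A. open U \<Longrightarrow> A \<in> U \<Longrightarrow> det A = 1 \<Longrightarrow>
           \<exists>g\<in>U. det g = 1 \<and> filterlim (\<lambda>A. g ** A ** adjugate g) \<Phi> \<Phi>"
begin

text \<open>The closure of the identity in the topology given by \<open>\<Phi>\<close>.\<close>

definition core :: "(complex ^ 'n ^ 'n) set" where
  "core = {u. \<forall>P. eventually P \<Phi> \<longrightarrow> P u}"

lemma coreD: "u \<in> core \<Longrightarrow> eventually P \<Phi> \<Longrightarrow> P u"
  unfolding core_def by blast

lemma filterlim_near_one:
  assumes "(f \<longlongrightarrow> mat 1) \<Psi>" "eventually (\<lambda>t. det (f t) = 1) \<Psi>"
  shows "filterlim f \<Phi> \<Psi>"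
  using assms by (intro filterlim_mono[OF _ coarser order_refl])
    (simp add: filterlim_inf filterlim_principal)

lemma filterlim_mult':
  assumes "filterlim f \<Phi> \<Psi>" "filterlim g \<Phi> \<Psi>"
  shows "filterlim (\<lambda>t. f t ** g t) \<Phi> \<Psi>"
  using filterlim_compose[OF filterlim_mult filterlim_Pair[OF assms]] by simp

lemma continuous_matrix_tendsto:
  fixes h :: "complex ^ 'n ^ 'n \<Rightarrow> 'b::topological_space"
  assumes "open S" "continuous_on S h" "u \<in> S" "(f \<longlongrightarrow> u) \<Psi>"
  shows "((\<lambda>t. h (f t)) \<longlongrightarrow> h u) \<Psi>"
  using assms by (metis continuous_on_eq_continuous_at isCont_tendsto_compose)

text \<open>If \<open>f\<close> tends to \<open>1\<close> coarsely and to \<open>u\<close> in the usual topology, then \<open>f\<^sup>-\<^sup>1 u\<close> tends to \<open>1\<close> in the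
usual topology, hence coarsely. So \<open>u\<close> is a product of two elements that are coarsely as close to \<open>1\<close> as
desired, and lies in every member of \<open>\<Phi>\<close>.\<close>

lemma limit_in_core:
  assumes "\<Psi> \<noteq> bot" "filterlim f \<Phi> \<Psi>" "(f \<longlongrightarrow> u) \<Psi>"
  shows "u \<in> core"
  unfolding core_def
proof (intro CollectI allI impI)
  fix P assume "eventually P \<Phi>"
  then have "eventually (\<lambda>(A, B). P (A ** B)) (\<Phi> \<times>\<^sub>F \<Phi>)"
    using filterlim_mult by (simp add: filterlim_iff split_def)
  then obtain Q R where QR: "eventually Q \<Phi>" "eventually R \<Phi>" "\<And>A B. Q A \<Longrightarrow> R B \<Longrightarrow> P (A ** B)"
    by (auto simp: eventually_prod_filter)
  have det_f: "eventually (\<lambda>t. det (f t) = 1) \<Psi>"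
    by (rule eventually_compose_filterlim[OF eventually_det assms(2)])
  have det_u: "det u = 1"
    using Lim_in_closed_set[OF closed_SL_UNIV _ assms(1,3)] det_f by simp
  have "((\<lambda>t. adjugate (f t) ** u) \<longlongrightarrow> adjugate u ** u) \<Psi>"
    by (rule continuous_matrix_tendsto[OF open_UNIV _ _ assms(3), where h = "\<lambda>Y. adjugate Y ** u"])
      (auto intro!: continuous_intros)
  then have "filterlim (\<lambda>t. adjugate (f t) ** u) \<Phi> \<Psi>"
    using det_u det_f by (intro filterlim_near_one)
      (auto simp: adjugate_left det_mul det_adjugate elim!: eventually_mono)
  then have "eventually (\<lambda>t. R (adjugate (f t) ** u)) \<Psi>" "eventually (\<lambda>t. Q (f t)) \<Psi>"
    using QR assms(2) by (auto simp: filterlim_iff)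
  then have "eventually (\<lambda>t. P u) \<Psi>"
    using det_f
  proof eventually_elim
    case (elim t)
    then have "P (f t ** (adjugate (f t) ** u))" using QR(3) by blast
    then show ?case using elim by (simp add: matrix_mul_assoc adjugate_right)
  qed
  then show "P u" using assms(1) by simp
qed

lemma core_det: "u \<in> core \<Longrightarrow> det u = 1"
  by (rule coreD[OF _ eventually_det])

lemma core_one: "mat 1 \<in> core"
  by (rule limit_in_core[where \<Psi> = "principal {mat 1}" and f = "\<lambda>t. t"])
    (auto simp: filterlim_near_one principal_eq_bot_iff tendsto_principal_singleton eventually_principal
      intro!: filterlim_near_one tendsto_eventually)

lemma core_mult:
  assumes "u \<in> core" "v \<in> core"
  shows "u ** v \<in> core"
  unfolding core_def
proof (intro CollectI allI impI)
  fix P assume "eventually P \<Phi>"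
  then have "eventually (\<lambda>(A, B). P (A ** B)) (\<Phi> \<times>\<^sub>F \<Phi>)"
    using filterlim_mult by (simp add: filterlim_iff split_def)
  then obtain Q R where "eventually Q \<Phi>" "eventually R \<Phi>" "\<And>A B. Q A \<Longrightarrow> R B \<Longrightarrow> P (A ** B)"
    by (auto simp: eventually_prod_filter)
  then show "P (u ** v)" using assms coreD by blast
qed

lemma closed_core: "closed core"
proof -
  have "u \<in> core" if u: "u \<in> closure core" for u
  proof (rule limit_in_core[where f = "\<lambda>t. t"])
    \<comment> \<open>the usual topology restricted to the core; coarsely its points are all indistinguishable from \<open>1\<close>\<close>
    let ?\<Psi> = "inf (nhds u) (principal core)"
    show "?\<Psi> \<noteq> bot"
    proof
      assume "?\<Psi> = bot"
      then have "eventually (\<lambda>x. x \<notin> core) (nhds u)"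
        using eventually_inf_principal[of "\<lambda>_. False" "nhds u" core] by simp
      then obtain U where "open U" "u \<in> U" "U \<inter> core = {}"
        by (auto simp: eventually_nhds)
      then show False using u open_Int_closure_eq_empty by blast
    qed
    show "filterlim (\<lambda>t. t) \<Phi> ?\<Psi>"
      by (auto simp: filterlim_iff eventually_inf_principal intro!: always_eventually dest: coreD)
    show "((\<lambda>t. t) \<longlongrightarrow> u) ?\<Psi>"
      by (rule filterlim_mono[OF filterlim_ident order_refl]) simp
  qed
  then show ?thesis by (metis closure_subset closure_closed subsetI subset_antisym closed_closure)
qed

text \<open>For \<open>A\<close> in a dense set this is part of the definition of a group filter; it extends to all \<open>A\<close> because
the core is closed and conjugation is continuous.\<close>

lemma core_conj:
  assumes "det A = 1" "A ** B = mat 1" "u \<in> core"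
  shows "A ** u ** B \<in> core"
proof (rule ccontr)
  assume *: "A ** u ** B \<notin> core"
  have B: "B = adjugate A" using assms adjugate_unique by blast
  have "closed ((\<lambda>g. g ** u ** adjugate g) -` core)"
    by (intro closed_vimage closed_core continuous_intros)
  then have "open (- ((\<lambda>g. g ** u ** adjugate g) -` core))" by blast
  moreover have "A \<in> - ((\<lambda>g. g ** u ** adjugate g) -` core)" using * B by simp
  ultimately obtain g where "g \<in> - ((\<lambda>g. g ** u ** adjugate g) -` core)"
      and lim: "filterlim (\<lambda>A. g ** A ** adjugate g) \<Phi> \<Phi>"
    using filterlim_conj assms(1) by blast
  then have g: "g ** u ** adjugate g \<notin> core" by simp
  have "P (g ** u ** adjugate g)" if "eventually P \<Phi>" for P
    by (rule coreD[OF assms(3) eventually_compose_filterlim[OF that lim]])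
  then show False using g unfolding core_def by blast
qed

text \<open>Let \<open>g\<close> be a limit point of \<open>A / \<parallel>A\<parallel>\<close> as \<open>A\<close> tends to infinity along \<open>\<Phi>\<close>. Then \<open>g \<noteq> 0\<close> and \<open>det g = 0\<close>,
so some column \<open>g e\<^sub>j\<close> is nonzero and some row vector \<open>y \<noteq> 0\<close> satisfies \<open>y g = 0\<close>. With \<open>s = A / \<parallel>A\<parallel>\<close> and
\<open>z\<close> a small correction of \<open>y\<close> for which \<open>z s e\<^sub>j = 0\<close>, the transvection \<open>h = 1 + c e\<^sub>j (z s)\<close> tends to \<open>1\<close>, since
\<open>z s\<close> tends to \<open>y g = 0\<close>, whereas its conjugate \<open>A h A\<^sup>-\<^sup>1 = 1 + c (s e\<^sub>j) z\<close> tends to the nontrivial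
transvection \<open>1 + c (g e\<^sub>j) y\<close>.\<close>

lemma unbounded_imp_core_everything:
  assumes unbounded: "\<And>R. \<not> eventually (\<lambda>A. norm A \<le> R) \<Phi>"
    and "det A = 1"
  shows "A \<in> core"
proof -
  define \<Psi>0 where "\<Psi>0 = inf \<Phi> at_infinity"
  have "\<Psi>0 \<noteq> bot"
  proof
    assume "\<Psi>0 = bot"
    then have "eventually (\<lambda>_. False) (inf \<Phi> at_infinity)" by (simp add: \<Psi>0_def)
    then obtain P Q where PQ: "eventually P \<Phi>" "eventually Q at_infinity" "\<And>x. P x \<Longrightarrow> Q x \<Longrightarrow> False"
      by (auto simp: eventually_inf)
    obtain b where "\<And>x. b \<le> norm x \<Longrightarrow> Q x"
      using PQ(2) by (auto simp: eventually_at_infinity)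
    then have "eventually (\<lambda>x. norm x \<le> b) \<Phi>"
      using PQ(1) by (elim eventually_mono) (metis PQ(3) linear)
    then show False using unbounded by blast
  qed
  define s where "s A = A /\<^sub>R norm A" for A :: "complex ^ 'n ^ 'n"
  have ev_pos: "eventually (\<lambda>A. norm A > 0) \<Psi>0"
  proof -
    have "eventually (\<lambda>A :: complex ^ 'n ^ 'n. norm A > 0) at_infinity"
      unfolding eventually_at_infinity by (intro exI[of _ 1]) auto
    then show ?thesis unfolding \<Psi>0_def by (rule filter_leD[rotated]) simp
  qed
  have "eventually (\<lambda>Y. Y \<in> sphere 0 1) (filtermap s \<Psi>0)"
    unfolding eventually_filtermap using ev_pos by eventually_elim (simp add: s_def)
  moreover have "filtermap s \<Psi>0 \<noteq> bot" using \<open>\<Psi>0 \<noteq> bot\<close> by (simp add: filtermap_bot_iff)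
  ultimately obtain g where g: "g \<in> sphere 0 1" "inf (nhds g) (filtermap s \<Psi>0) \<noteq> bot"
    using compact_sphere compact_filter by metis
  \<comment> \<open>pass to a subfilter along which \<open>s\<close> converges to \<open>g\<close>\<close>
  define \<Psi> where "\<Psi> = inf \<Psi>0 (filtercomap s (nhds g))"
  have nb: "\<Psi> \<noteq> bot" unfolding \<Psi>_def by (rule inf_filtercomap_neq_bot[OF g(2)])
  have le: "\<Psi> \<le> \<Phi>" "\<Psi> \<le> \<Psi>0" "\<Psi> \<le> at_infinity"
    by (auto simp: \<Psi>_def \<Psi>0_def intro: le_infI1)
  have s_lim: "(s \<longlongrightarrow> g) \<Psi>"
    unfolding \<Psi>_def by (rule filterlim_mono[OF filterlim_filtercomap order_refl]) simp
  have det1: "eventually (\<lambda>A. det A = 1) \<Psi>" using filter_leD[OF le(1) eventually_det] .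
  have pos: "eventually (\<lambda>A. norm A > 0) \<Psi>" using filter_leD[OF le(2) ev_pos] .
  have s_eq: "s A = mat (of_real (inverse (norm A))) ** A" for A
    by (simp add: vec_eq_iff mat_mult_nth s_def) (simp add: scaleR_conv_of_real)
  have "det g = 0"
  proof (rule tendsto_unique[OF nb])
    show "((\<lambda>A. det (s A)) \<longlongrightarrow> det g) \<Psi>"
      by (rule continuous_matrix_tendsto[OF open_UNIV _ _ s_lim]) (auto intro!: continuous_intros)
    have "filterlim (\<lambda>A :: complex ^ 'n ^ 'n. norm A) at_top \<Psi>"
      by (rule filterlim_mono[OF filterlim_norm_at_top order_refl le(3)])
    then have "((\<lambda>A. inverse (norm A)) \<longlongrightarrow> 0) \<Psi>"
      by (rule tendsto_inverse_0_at_top)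
    then have "((\<lambda>A. of_real (inverse (norm A)) ^ CARD('n) :: complex) \<longlongrightarrow> of_real 0 ^ CARD('n)) \<Psi>"
      by (intro tendsto_intros)
    then have "((\<lambda>A. of_real (inverse (norm A)) ^ CARD('n) :: complex) \<longlongrightarrow> 0) \<Psi>"
      by (simp add: zero_power)
    moreover have "eventually (\<lambda>A. of_real (inverse (norm A)) ^ CARD('n) = det (s A)) \<Psi>"
      using det1 by eventually_elim (simp only: s_eq det_mul det_mat mult_1_right)
    ultimately show "((\<lambda>A. det (s A)) \<longlongrightarrow> 0) \<Psi>"
      by (rule Lim_transform_eventually)
  qed
  then have "\<not> invertible (transpose g)" by (simp add: invertible_det_nz)
  then obtain y where y: "y \<noteq> 0" "y v* g = 0"
    using matrix_left_invertible_ker[of "transpose g"]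
    by (metis invertible_left_inverse transpose_matrix_vector)
  have "g \<noteq> 0" using g(1) by auto
  then obtain i j where ij: "g $ i $ j \<noteq> 0" by (auto simp: vec_eq_iff)
  \<comment> \<open>correcting \<open>y\<close> in coordinate \<open>i\<close> only; the divisor tends to \<open>g $ i $ j \<noteq> 0\<close>\<close>
  define z where "z Y = y - (pairing y (column j Y) / Y $ i $ j) *s axis i 1" for Y :: "complex ^ 'n ^ 'n"
  have z_g: "z g = y" using y(2) by (simp add: z_def pairing_column)
  have z_orth: "pairing (z Y) (column j Y) = 0" if "Y $ i $ j \<noteq> 0" for Y
    using that by (simp add: z_def pairing_simps column_def)
  have cont_z: "continuous_on {Y. Y $ i $ j \<noteq> 0} z"
    unfolding z_def by (intro continuous_intros) auto
  have open_ij: "open {Y :: complex ^ 'n ^ 'n. Y $ i $ j \<noteq> 0}"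
    by (intro open_Collect_neq continuous_intros)
  have nz: "eventually (\<lambda>A. s A $ i $ j \<noteq> 0) \<Psi>"
    using topological_tendstoD[OF s_lim open_ij] ij by simp
  have line: "transvection (c *s column j g) y \<in> core" for c
  proof -
    define h where "h Y = transvection (axis j c) (z Y v* Y)" for Y :: "complex ^ 'n ^ 'n"
    define k where "k Y = transvection (c *s column j Y) (z Y)" for Y :: "complex ^ 'n ^ 'n"
    have "((\<lambda>A. h (s A)) \<longlongrightarrow> h g) \<Psi>"
      by (rule continuous_matrix_tendsto[OF open_ij _ _ s_lim])
        (auto simp: h_def ij intro!: continuous_intros cont_z)
    then have h_lim: "((\<lambda>A. h (s A)) \<longlongrightarrow> mat 1) \<Psi>" by (simp add: h_def z_g y)
    have "eventually (\<lambda>A. det (h (s A)) = 1) \<Psi>"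
      using nz
    proof eventually_elim
      case (elim A)
      then show ?case using z_orth[OF elim]
        by (simp add: h_def det_transvection pairing_simps pairing_column)
    qed
    then have h\<Phi>: "filterlim (\<lambda>A. h (s A)) \<Phi> \<Psi>"
      by (rule filterlim_near_one[OF h_lim])
    have id\<Phi>: "filterlim (\<lambda>A. A) \<Phi> \<Psi>"
      using le(1) by (simp add: filterlim_def)
    have f\<Phi>: "filterlim (\<lambda>A. A ** h (s A) ** adjugate A) \<Phi> \<Psi>"
      by (intro filterlim_mult' h\<Phi> id\<Phi> filterlim_compose[OF filterlim_adjugate])
    have "((\<lambda>A. k (s A)) \<longlongrightarrow> k g) \<Psi>"
      by (rule continuous_matrix_tendsto[OF open_ij _ _ s_lim])
        (auto simp: k_def ij intro!: continuous_intros cont_z)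
    moreover have "eventually (\<lambda>A. k (s A) = A ** h (s A) ** adjugate A) \<Psi>"
      using pos det1
    proof eventually_elim
      case (elim A)
      have "A ** h (s A) ** adjugate A = transvection (A *v axis j c) ((z (s A) v* s A) v* adjugate A)"
        unfolding h_def by (rule transvection_conjugate[OF adjugate_right[OF elim(2)]])
      also have "(z (s A) v* s A) v* adjugate A = z (s A) v* mat (of_real (inverse (norm A)))"
        by (simp add: vector_matrix_mul_assoc s_eq matrix_mul_assoc[symmetric] adjugate_right[OF elim(2)])
      also have "\<dots> = of_real (inverse (norm A)) *s z (s A)"
        by (simp add: vec_eq_iff vector_matrix_mult_def mat_def if_distrib[of "\<lambda>t. _ * t"]
            if_distrib[of "\<lambda>t. t * _"] mult.commute cong: if_cong)
      also have "transvection (A *v axis j c) (of_real (inverse (norm A)) *s z (s A))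
          = transvection (of_real (inverse (norm A)) *s (A *v axis j c)) (z (s A))"
        by (rule transvection_smult[symmetric])
      also have "of_real (inverse (norm A)) *s (A *v axis j c) = c *s column j (s A)"
        by (simp add: vec_eq_iff column_def s_eq mat_mult_nth matrix_vector_mult_def axis_nth_if
            if_distrib[of "\<lambda>t. _ * t"] mult_ac cong: if_cong)
      finally show ?case by (simp add: k_def)
    qed
    ultimately have "((\<lambda>A. A ** h (s A) ** adjugate A) \<longlongrightarrow> k g) \<Psi>"
      by (rule Lim_transform_eventually)
    then show ?thesis
      using limit_in_core[OF nb f\<Phi>] by (simp add: k_def z_g)
  qed
  have col: "column j g \<noteq> 0" using ij by (auto simp: column_def vec_eq_iff)
  have orth: "pairing y (column j g) = 0" using y(2) by (simp add: pairing_column)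
  have "transvection x' y' \<in> core" if "pairing y' x' = 0" for x' y'
    using transvections_conjugate_line[OF core_conj line col y(1) orth that] by blast
  then show ?thesis
    using transvections_generate[of core A] core_mult assms(2) by blast
qed

lemma bounded_imp_core_scalar:
  assumes "eventually (\<lambda>A. norm A \<le> R) \<Phi>" "u \<in> core"
  shows "\<exists>c. c ^ CARD('n) = 1 \<and> u = mat c"
proof -
  have "norm (A ** u ** B) \<le> R" if "det A = 1" "A ** B = mat 1" for A B
    using coreD[OF core_conj[OF that assms(2)] assms(1)] .
  then obtain c where "u = mat c" using bounded_conjugates_imp_scalar by blast
  then show ?thesis using core_det[OF assms(2)] det_mat[of c] by metis
qed

text \<open>Otherwise \<open>\<Phi>\<close> has, by compactness, a limit point outside \<open>U\<close>; but its limit points lie in the core.\<close>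

lemma bounded_imp_eventually_near_core:
  assumes "eventually (\<lambda>A. norm A \<le> R) \<Phi>" "open U" "core \<subseteq> U"
  shows "eventually (\<lambda>A. A \<in> U) \<Phi>"
proof (rule ccontr)
  assume *: "\<not> eventually (\<lambda>A. A \<in> U) \<Phi>"
  define \<Psi> where "\<Psi> = inf \<Phi> (principal (- U))"
  have "\<Psi> \<noteq> bot"
    using * eventually_inf_principal[of "\<lambda>_. False" \<Phi> "- U"] by (auto simp: \<Psi>_def)
  moreover have "eventually (\<lambda>A. A \<in> cball 0 R - U) \<Psi>"
    using assms(1) unfolding \<Psi>_def eventually_inf_principal by eventually_elim simp
  moreover have "compact (cball 0 R - U)" using assms(2) by (simp add: compact_diff)
  ultimately obtain u where u: "u \<in> cball 0 R - U" "inf (nhds u) \<Psi> \<noteq> bot"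
    unfolding compact_filter by blast
  have "filterlim (\<lambda>A. A) \<Phi> (inf (nhds u) \<Psi>)"
    by (auto simp: filterlim_def \<Psi>_def intro: le_infI2)
  moreover have "((\<lambda>A. A) \<longlongrightarrow> u) (inf (nhds u) \<Psi>)"
    by (rule filterlim_mono[OF filterlim_ident order_refl]) simp
  ultimately have "u \<in> core" using limit_in_core u(2) by blast
  then show False using u(1) assms(3) by blast
qed

end

section \<open>Topological groups and their quotients\<close>

lemma topological_groupD:
  assumes "topological_group H S"
  shows "Group.group H" "topspace S = carrier H" "Hausdorff_space S"
    "continuous_map (prod_topology S S) S (\<lambda>(x, y). x \<otimes>\<^bsub>H\<^esub> y)"
    "continuous_map S S (\<lambda>x. inv\<^bsub>H\<^esub> x)"
  using assms by (auto simp: topological_group_def)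

lemma topological_group_mult_nhds:
  assumes "topological_group H S" "openin S U" "x \<in> carrier H" "y \<in> carrier H" "x \<otimes>\<^bsub>H\<^esub> y \<in> U"
  obtains V W where "openin S V" "openin S W" "x \<in> V" "y \<in> W"
    "\<And>a b. a \<in> V \<Longrightarrow> b \<in> W \<Longrightarrow> a \<otimes>\<^bsub>H\<^esub> b \<in> U"
proof -
  note D = topological_groupD[OF assms(1)]
  have "openin (prod_topology S S) {z \<in> topspace (prod_topology S S). (\<lambda>(x, y). x \<otimes>\<^bsub>H\<^esub> y) z \<in> U}"
    using D(4) assms(2) by (rule openin_continuous_map_preimage)
  moreover have "(x, y) \<in> {z \<in> topspace (prod_topology S S). (\<lambda>(x, y). x \<otimes>\<^bsub>H\<^esub> y) z \<in> U}"
    using assms D(2) by simp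
  ultimately have "\<exists>V W. openin S V \<and> openin S W \<and> x \<in> V \<and> y \<in> W \<and>
      V \<times> W \<subseteq> {z \<in> topspace (prod_topology S S). (\<lambda>(x, y). x \<otimes>\<^bsub>H\<^esub> y) z \<in> U}"
    by (rule openin_prod_topology_alt[THEN iffD1, rule_format])
  then obtain V W where VW: "openin S V" "openin S W" "x \<in> V" "y \<in> W"
    "V \<times> W \<subseteq> {z \<in> topspace (prod_topology S S). (\<lambda>(x, y). x \<otimes>\<^bsub>H\<^esub> y) z \<in> U}"
    by (elim exE conjE)
  have "a \<otimes>\<^bsub>H\<^esub> b \<in> U" if "a \<in> V" "b \<in> W" for a b
    using subsetD[OF VW(5), of "(a, b)"] that by simp
  then show ?thesis by (rule that[OF VW(1-4)])
qed

lemma topological_group_left_translation: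
  assumes "topological_group H S" "a \<in> carrier H"
  shows "continuous_map S S (\<lambda>x. a \<otimes>\<^bsub>H\<^esub> x)"
proof -
  note D = topological_groupD[OF assms(1)]
  have "continuous_map S (prod_topology S S) (\<lambda>x. (a, x))"
    by (intro continuous_map_pairedI) (auto simp: D assms)
  from continuous_map_compose[OF this D(4)] show ?thesis by (simp add: o_def)
qed

lemma topological_group_right_translation:
  assumes "topological_group H S" "a \<in> carrier H"
  shows "continuous_map S S (\<lambda>x. x \<otimes>\<^bsub>H\<^esub> a)"
proof -
  note D = topological_groupD[OF assms(1)]
  have "continuous_map S (prod_topology S S) (\<lambda>x. (x, a))"
    by (intro continuous_map_pairedI) (auto simp: D assms)
  from continuous_map_compose[OF this D(4)] show ?thesis by (simp add: o_def)
qed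

text \<open>Openness of \<open>f\<close> transports the neighbourhoods that witness continuity in \<open>G\<close> to \<open>H\<close>. The Hausdorff
property comes from the complement of the kernel: it is an open set containing \<open>a\<^sup>-\<^sup>1 b\<close> whenever
\<open>f a \<noteq> f b\<close>.\<close>

lemma topological_group_open_image:
  fixes G :: "('a, 'c) monoid_scheme" and H :: "('b, 'd) monoid_scheme"
  assumes G: "topological_group G T" and H: "Group.group H" "topspace S = carrier H"
    and f: "f \<in> hom G H" "f ` carrier G = carrier H" "continuous_map T S f" "open_map T S f"
    and ker: "closedin T (kernel G H f)"
  shows "topological_group H S"
proof -
  note D = topological_groupD[OF G]
  interpret G: Group.group G by (rule D(1))
  interpret H: Group.group H by (rule H(1))
  interpret f: group_hom G H f using f(1) by unfold_locales
  have pre: "openin T {x \<in> carrier G. f x \<in> U}" if "openin S U" for U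
    using openin_continuous_map_preimage[OF f(3) that] D(2) by simp
  have im: "openin S (f ` U)" if "openin T U" for U
    using f(4) that by (simp add: open_map_def)
  have sub: "x \<in> U \<Longrightarrow> x \<in> carrier G" if "openin T U" for U x
    using openin_subset[OF that] D(2) by blast
  show ?thesis
    unfolding topological_group_def
  proof (intro conjI)
    show "continuous_map (prod_topology S S) S (\<lambda>(x, y). x \<otimes>\<^bsub>H\<^esub> y)"
      unfolding continuous_map_def
    proof (intro conjI allI impI)
      fix U assume U: "openin S U"
      let ?P = "{z \<in> topspace (prod_topology S S). (case z of (x, y) \<Rightarrow> x \<otimes>\<^bsub>H\<^esub> y) \<in> U}"
      have "\<exists>V W. openin S V \<and> openin S W \<and> x \<in> V \<and> y \<in> W \<and> V \<times> W \<subseteq> ?P" if xy: "(x, y) \<in> ?P" for x y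
      proof -
        obtain a b where ab: "a \<in> carrier G" "b \<in> carrier G" "x = f a" "y = f b"
        proof -
          have "x \<in> f ` carrier G" "y \<in> f ` carrier G" using xy f(2) H(2) by auto
          then show ?thesis using that by blast
        qed
        have "a \<otimes>\<^bsub>G\<^esub> b \<in> {x \<in> carrier G. f x \<in> U}" using xy ab by auto
        then obtain V W where VW: "openin T V" "openin T W" "a \<in> V" "b \<in> W"
          "\<And>a b. a \<in> V \<Longrightarrow> b \<in> W \<Longrightarrow> a \<otimes>\<^bsub>G\<^esub> b \<in> {x \<in> carrier G. f x \<in> U}"
          using topological_group_mult_nhds[OF G pre[OF U] ab(1,2)] by blast
        have "f ` V \<times> f ` W \<subseteq> ?P"
        proof
          fix z assume "z \<in> f ` V \<times> f ` W"
          then obtain c d where cd: "c \<in> V" "d \<in> W" "z = (f c, f d)" by blast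
          then have "c \<in> carrier G" "d \<in> carrier G" using sub VW by blast+
          then show "z \<in> ?P" using VW(5)[OF cd(1,2)] cd(3) H(2) by simp
        qed
        then show ?thesis
          using im VW(1-4) ab by (intro exI[of _ "f ` V"] exI[of _ "f ` W"]) auto
      qed
      then show "openin (prod_topology S S) ?P"
        unfolding openin_prod_topology_alt by (intro allI impI)
    qed (use H(2) in auto)
    show "continuous_map S S (\<lambda>x. inv\<^bsub>H\<^esub> x)"
      unfolding continuous_map_def
    proof (intro conjI allI impI)
      fix U assume U: "openin S U"
      have "openin T {x \<in> topspace T. inv\<^bsub>G\<^esub> x \<in> {x \<in> carrier G. f x \<in> U}}"
        by (rule openin_continuous_map_preimage[OF D(5) pre[OF U]])
      then have "openin S (f ` {x \<in> topspace T. inv\<^bsub>G\<^esub> x \<in> {x \<in> carrier G. f x \<in> U}})"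
        by (rule im)
      also have "f ` {x \<in> topspace T. inv\<^bsub>G\<^esub> x \<in> {x \<in> carrier G. f x \<in> U}}
          = {x \<in> topspace S. inv\<^bsub>H\<^esub> x \<in> U}"
        unfolding D(2) H(2) f(2)[symmetric] by auto
      finally show "openin S {x \<in> topspace S. inv\<^bsub>H\<^esub> x \<in> U}" .
    qed (use H(2) in auto)
    show "Hausdorff_space S"
      unfolding Hausdorff_space_def
    proof (intro allI impI)
      fix x y assume xy: "x \<in> topspace S \<and> y \<in> topspace S \<and> x \<noteq> y"
      obtain a b where ab: "a \<in> carrier G" "b \<in> carrier G" "x = f a" "y = f b"
      proof -
        have "x \<in> f ` carrier G" "y \<in> f ` carrier G" using xy f(2) H(2) by auto
        then show ?thesis using that by blast
      qed
      have ne: "inv\<^bsub>G\<^esub> a \<otimes>\<^bsub>G\<^esub> b \<notin> kernel G H f"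
      proof
        assume "inv\<^bsub>G\<^esub> a \<otimes>\<^bsub>G\<^esub> b \<in> kernel G H f"
        then have "inv\<^bsub>H\<^esub> (f a) \<otimes>\<^bsub>H\<^esub> f b = \<one>\<^bsub>H\<^esub>" using ab by (simp add: kernel_def)
        then have "f b = f a"
          using ab by (metis H.inv_closed H.inv_equality H.inv_inv f.hom_closed)
        then show False using xy ab by simp
      qed
      have "openin T (topspace T - kernel G H f)" using ker by (simp add: closedin_def)
      moreover have "inv\<^bsub>G\<^esub> a \<otimes>\<^bsub>G\<^esub> b \<in> topspace T - kernel G H f" using ne ab D(2) by simp
      ultimately obtain V W where VW: "openin T V" "openin T W" "inv\<^bsub>G\<^esub> a \<in> V" "b \<in> W"
          "\<And>a b. a \<in> V \<Longrightarrow> b \<in> W \<Longrightarrow> a \<otimes>\<^bsub>G\<^esub> b \<in> topspace T - kernel G H f"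
        using topological_group_mult_nhds[OF G _ G.inv_closed[OF ab(1)] ab(2)] by blast
      define V' where "V' = {x \<in> topspace T. inv\<^bsub>G\<^esub> x \<in> V}"
      have V': "openin T V'" unfolding V'_def by (rule openin_continuous_map_preimage[OF D(5) VW(1)])
      have "f c \<noteq> f d" if "c \<in> V'" "d \<in> W" for c d
      proof
        assume eq: "f c = f d"
        have cd: "c \<in> carrier G" "d \<in> carrier G" "inv\<^bsub>G\<^esub> c \<in> V"
          using that sub[OF VW(2)] D(2) by (auto simp: V'_def)
        then have "inv\<^bsub>G\<^esub> c \<otimes>\<^bsub>G\<^esub> d \<in> kernel G H f" using eq by (simp add: kernel_def)
        then show False using VW(5)[OF cd(3) that(2)] by simp
      qed
      then have "disjnt (f ` V') (f ` W)" by (auto simp: disjnt_def)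
      moreover have "a \<in> V'" using ab VW(3) D(2) by (simp add: V'_def)
      ultimately show "\<exists>U V. openin S U \<and> openin S V \<and> x \<in> U \<and> y \<in> V \<and> disjnt U V"
        using im[OF V'] im[OF VW(2)] VW(4) ab
        by (intro exI[of _ "f ` V'"] exI[of _ "f ` W"]) auto
    qed
  qed (use H in auto)
qed

lemma kernel_r_coset:
  assumes "N \<lhd> G"
  shows "kernel G (G Mod N) (\<lambda>x. N #>\<^bsub>G\<^esub> x) = N"
proof -
  interpret normal N G by (rule assms)
  have "N #>\<^bsub>G\<^esub> x = N \<longleftrightarrow> x \<in> N" if "x \<in> carrier G" for x
    using that coset_join1 coset_join2 subgroup_axioms rcos_const by (metis is_group subset)
  then show ?thesis using subset by (auto simp: kernel_def FactGroup_def)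
qed

text \<open>The saturation of an open set is the union of its translates by the elements of \<open>N\<close>.\<close>

lemma open_map_r_coset:
  assumes G: "topological_group G T" and N: "N \<lhd> G"
  shows "open_map T (quotient_group_topology G T N) (\<lambda>x. N #>\<^bsub>G\<^esub> x)"
  unfolding open_map_def openin_quotient_group_topology
proof (intro allI impI conjI)
  note D = topological_groupD[OF G]
  interpret normal N G by (rule N)
  fix U assume U: "openin T U"
  have sub: "U \<subseteq> carrier G" using openin_subset[OF U] D(2) by simp
  then show "(\<lambda>x. N #>\<^bsub>G\<^esub> x) ` U \<subseteq> carrier (G Mod N)"
    by (auto simp: FactGroup_def RCOSETS_def)
  have "{x \<in> topspace T. N #>\<^bsub>G\<^esub> x \<in> (\<lambda>x. N #>\<^bsub>G\<^esub> x) ` U}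
      = (\<Union>k\<in>N. {x \<in> topspace T. k \<otimes>\<^bsub>G\<^esub> x \<in> U})"
  proof (intro subset_antisym subsetI)
    fix x assume "x \<in> {x \<in> topspace T. N #>\<^bsub>G\<^esub> x \<in> (\<lambda>x. N #>\<^bsub>G\<^esub> x) ` U}"
    then obtain u where u: "x \<in> carrier G" "u \<in> U" "N #>\<^bsub>G\<^esub> x = N #>\<^bsub>G\<^esub> u" using D(2) by auto
    then have "u \<in> N #>\<^bsub>G\<^esub> x" using sub rcos_self by (metis is_group subgroup_axioms subset_iff)
    then obtain k where "k \<in> N" "u = k \<otimes>\<^bsub>G\<^esub> x" by (auto simp: r_coset_def)
    then show "x \<in> (\<Union>k\<in>N. {x \<in> topspace T. k \<otimes>\<^bsub>G\<^esub> x \<in> U})" using u D(2) by auto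
  next
    fix x assume "x \<in> (\<Union>k\<in>N. {x \<in> topspace T. k \<otimes>\<^bsub>G\<^esub> x \<in> U})"
    then obtain k where k: "k \<in> N" "x \<in> carrier G" "k \<otimes>\<^bsub>G\<^esub> x \<in> U" using D(2) by auto
    then have "N #>\<^bsub>G\<^esub> (k \<otimes>\<^bsub>G\<^esub> x) = N #>\<^bsub>G\<^esub> x"
      using coset_mult_assoc[of N k x] coset_join2[of k N] subset subgroup_axioms by auto
    then show "x \<in> {x \<in> topspace T. N #>\<^bsub>G\<^esub> x \<in> (\<lambda>x. N #>\<^bsub>G\<^esub> x) ` U}"
      using k D(2) by (metis (mono_tags, lifting) image_eqI mem_Collect_eq)
  qed
  moreover have "openin T (\<Union>k\<in>N. {x \<in> topspace T. k \<otimes>\<^bsub>G\<^esub> x \<in> U})"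
    using subset by (intro openin_Union) (auto intro!: openin_continuous_map_preimage[OF _ U]
        topological_group_left_translation[OF G])
  ultimately show "openin T {x \<in> topspace T. N #>\<^bsub>G\<^esub> x \<in> (\<lambda>x. N #>\<^bsub>G\<^esub> x) ` U}" by simp
qed

lemma topological_group_Mod:
  assumes G: "topological_group G T" and N: "N \<lhd> G" "closedin T N"
  shows "topological_group (G Mod N) (quotient_group_topology G T N)"
proof (rule topological_group_open_image[OF G])
  note D = topological_groupD[OF G]
  have quot: "quotient_map T (quotient_group_topology G T N) (\<lambda>x. N #>\<^bsub>G\<^esub> x)"
    by (rule quotient_map_quotient_group_topology[OF D(2)])
  show "Group.group (G Mod N)" by (rule normal.factorgroup_is_group[OF N(1)])
  show "(\<lambda>x. N #>\<^bsub>G\<^esub> x) \<in> hom G (G Mod N)" by (rule normal.r_coset_hom_Mod[OF N(1)])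
  show im: "(\<lambda>x. N #>\<^bsub>G\<^esub> x) ` carrier G = carrier (G Mod N)"
    by (auto simp: FactGroup_def RCOSETS_def)
  show "topspace (quotient_group_topology G T N) = carrier (G Mod N)"
    using quotient_imp_surjective_map[OF quot] im D(2) by simp
  show "continuous_map T (quotient_group_topology G T N) (\<lambda>x. N #>\<^bsub>G\<^esub> x)"
    by (rule quotient_imp_continuous_map[OF quot])
  show "open_map T (quotient_group_topology G T N) (\<lambda>x. N #>\<^bsub>G\<^esub> x)"
    by (rule open_map_r_coset[OF G N(1)])
  show "closedin T (kernel G (G Mod N) (\<lambda>x. N #>\<^bsub>G\<^esub> x))"
    using N kernel_r_coset by metis
qed

section \<open>Continuous homomorphisms out of the special linear group\<close>

lemma closure_image2:
  fixes f :: "'a::topological_space \<Rightarrow> 'b::topological_space \<Rightarrow> 'c::topological_space"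
  assumes "continuous_on UNIV (\<lambda>z. f (fst z) (snd z))"
    and "\<And>x y. x \<in> P \<Longrightarrow> y \<in> Q \<Longrightarrow> f x y \<in> R" and "a \<in> closure P" "b \<in> closure Q"
  shows "f a b \<in> closure R"
proof -
  have "(\<lambda>z. f (fst z) (snd z)) ` closure (P \<times> Q) \<subseteq> closure R"
    by (rule image_closure_subset[OF continuous_on_subset[OF assms(1)]])
      (use assms(2) closure_subset[of R] in auto)
  moreover have "(a, b) \<in> closure (P \<times> Q)" using assms(3,4) by (simp add: closure_Times)
  ultimately show ?thesis by force
qed

lemma closure_image1:
  fixes f :: "'a::topological_space \<Rightarrow> 'b::topological_space"
  assumes "continuous_on UNIV f" and "\<And>x. x \<in> P \<Longrightarrow> f x \<in> R" and "a \<in> closure P"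
  shows "f a \<in> closure R"
  using image_closure_subset[OF continuous_on_subset[OF assms(1)] closed_closure, of P R] assms(2,3)
    closure_subset[of R] by blast

locale SL_quotient = dense_complex_subfield F
  for F :: "complex set" +
  fixes H :: "('h, 'm) monoid_scheme" and S :: "'h topology" and f :: "complex ^ 'n ^ 'n \<Rightarrow> 'h"
  assumes H: "topological_group H S"
    and hom: "f \<in> hom (SL F) H" and surj: "f ` carrier (SL F) = carrier H"
    and cont: "continuous_map (SL_topology F) S f"
begin

lemmas HD = topological_groupD[OF H]

sublocale H: Group.group H
  by (rule HD(1))

lemma f_mult: "A \<in> carrier (SL F) \<Longrightarrow> B \<in> carrier (SL F) \<Longrightarrow> f (A ** B) = f A \<otimes>\<^bsub>H\<^esub> f B"
  using hom_mult[OF hom] by (simp add: mult_SL)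

lemma f_closed: "A \<in> carrier (SL F) \<Longrightarrow> f A \<in> carrier H"
  using surj by blast

lemma mat_one_SL: "mat 1 \<in> carrier (SL F :: (complex ^ 'n ^ 'n) monoid)"
  using group.is_monoid[OF group_SL] monoid.one_closed one_SL by metis

lemma f_one: "f (mat 1) = \<one>\<^bsub>H\<^esub>"
  using hom_one[OF hom group_SL H.is_group] by (simp add: one_SL)

lemma f_adjugate: "A \<in> carrier (SL F) \<Longrightarrow> f (adjugate A) = inv\<^bsub>H\<^esub> (f A)"
  by (rule H.inv_equality[symmetric])
    (simp_all add: f_closed adjugate_SL f_mult[symmetric] adjugate_left carrier_SL[of A] f_one)

lemma open_preimage:
  assumes "openin S U"
  shows "\<exists>V. open V \<and> (\<forall>A\<in>carrier (SL F). f A \<in> U \<longleftrightarrow> A \<in> V)"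
proof -
  have "openin (SL_topology F) {A \<in> carrier (SL F). f A \<in> U}"
    using openin_continuous_map_preimage[OF cont assms] by (simp add: topspace_SL)
  then obtain V where "open V" "{A \<in> carrier (SL F). f A \<in> U} = V \<inter> carrier (SL F)"
    by (auto simp: SL_topology_def openin_subtopology)
  then show ?thesis by blast
qed

definition cl_preimage :: "'h set \<Rightarrow> (complex ^ 'n ^ 'n) set" where
  "cl_preimage U = closure {A \<in> carrier (SL F). f A \<in> U}"

text \<open>The neighbourhoods of \<open>1\<close> in the topology that \<open>f\<close> induces on \<open>SL(n,F)\<close>, carried over to \<open>SL(n,\<complex>)\<close> by
taking closures.\<close>

definition \<Phi> :: "(complex ^ 'n ^ 'n) filter" where
  "\<Phi> = (INF U\<in>{U. openin S U \<and> \<one>\<^bsub>H\<^esub> \<in> U}. principal (cl_preimage U))"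

lemma cl_preimage_mono: "U \<subseteq> V \<Longrightarrow> cl_preimage U \<subseteq> cl_preimage V"
  unfolding cl_preimage_def by (intro closure_mono) auto

lemma eventually_\<Phi>:
  "eventually P \<Phi> \<longleftrightarrow> (\<exists>U. openin S U \<and> \<one>\<^bsub>H\<^esub> \<in> U \<and> (\<forall>A\<in>cl_preimage U. P A))"
  unfolding \<Phi>_def
proof (subst eventually_INF_base)
  have "openin S (carrier H)" using HD(2) openin_topspace by metis
  then show "{U. openin S U \<and> \<one>\<^bsub>H\<^esub> \<in> U} \<noteq> {}" by auto
  fix U V assume "U \<in> {U. openin S U \<and> \<one>\<^bsub>H\<^esub> \<in> U}" "V \<in> {U. openin S U \<and> \<one>\<^bsub>H\<^esub> \<in> U}"
  then have "U \<inter> V \<in> {U. openin S U \<and> \<one>\<^bsub>H\<^esub> \<in> U}" by auto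
  moreover have "principal (cl_preimage (U \<inter> V)) \<le> inf (principal (cl_preimage U)) (principal (cl_preimage V))"
    by (simp add: cl_preimage_mono)
  ultimately show "\<exists>x\<in>{U. openin S U \<and> \<one>\<^bsub>H\<^esub> \<in> U}. principal (cl_preimage x)
      \<le> inf (principal (cl_preimage U)) (principal (cl_preimage V))" by blast
qed (auto simp: eventually_principal)

lemma cl_preimage_det: "A \<in> cl_preimage U \<Longrightarrow> det A = 1"
  using closure_minimal[OF _ closed_SL_UNIV, of "{A \<in> carrier (SL F). f A \<in> U}"]
  by (auto simp: cl_preimage_def carrier_SL)

text \<open>An open set of matrices that agrees with \<open>f -` U\<close> on \<open>SL(n,F)\<close> lies, within \<open>SL(n,\<complex>)\<close>, in the closure of
\<open>f -` U\<close> because \<open>SL(n,F)\<close> is dense.\<close>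

lemma cl_preimage_near_one:
  assumes U: "openin S U" "\<one>\<^bsub>H\<^esub> \<in> U"
  shows "\<exists>V. open V \<and> mat 1 \<in> V \<and> (\<forall>A\<in>V. det A = 1 \<longrightarrow> A \<in> cl_preimage U)"
proof -
  obtain V where V: "open V" "\<forall>A\<in>carrier (SL F). f A \<in> U \<longleftrightarrow> A \<in> V"
    using open_preimage[OF U(1)] by blast
  have "A \<in> cl_preimage U" if A: "A \<in> V" "det A = 1" for A
    unfolding cl_preimage_def closure_iff_nhds_not_empty
  proof (intro allI impI)
    fix W W' assume W: "W' \<subseteq> W" "open W'" "A \<in> W'"
    have "open (W' \<inter> V)" "A \<in> W' \<inter> V" using W A(1) V(1) by auto
    then obtain B where B: "B \<in> W' \<inter> V" "B \<in> carrier (SL F)"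
      using SL_dense[OF A(2)] by blast
    then have "f B \<in> U" using V(2) by simp
    then have "B \<in> {A \<in> carrier (SL F). f A \<in> U} \<inter> W" using B W(1) by auto
    then show "{A \<in> carrier (SL F). f A \<in> U} \<inter> W \<noteq> {}" by (simp only: ex_in_conv[symmetric]) (rule exI)
  qed
  moreover have "mat 1 \<in> V" using bspec[OF V(2) mat_one_SL] U(2) by (simp add: f_one)
  ultimately show ?thesis using V(1) by blast
qed

sublocale group_filter \<Phi>
proof
  show "eventually (\<lambda>A. det A = 1) \<Phi>"
    unfolding eventually_\<Phi> using HD(2) openin_topspace[of S] H.one_closed
    by (intro exI[of _ "carrier H"]) (auto dest: cl_preimage_det)
  show "inf (nhds (mat 1)) (principal {A. det A = 1}) \<le> \<Phi>"
  proof (rule filter_leI)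
    fix P assume "eventually P \<Phi>"
    then obtain U where U: "openin S U" "\<one>\<^bsub>H\<^esub> \<in> U" "\<forall>A\<in>cl_preimage U. P A"
      by (auto simp: eventually_\<Phi>)
    obtain V where "open V" "mat 1 \<in> V" "\<forall>A\<in>V. det A = 1 \<longrightarrow> A \<in> cl_preimage U"
      using cl_preimage_near_one[OF U(1,2)] by blast
    then show "eventually P (inf (nhds (mat 1)) (principal {A. det A = 1}))"
      using U(3) by (auto simp: eventually_inf_principal eventually_nhds)
  qed
  show "filterlim (\<lambda>(A, B). A ** B) \<Phi> (\<Phi> \<times>\<^sub>F \<Phi>)"
    unfolding filterlim_iff
  proof (intro allI impI)
    fix P assume "eventually P \<Phi>"
    then obtain U where U: "openin S U" "\<one>\<^bsub>H\<^esub> \<in> U" "\<forall>A\<in>cl_preimage U. P A"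
      by (auto simp: eventually_\<Phi>)
    have "\<one>\<^bsub>H\<^esub> \<otimes>\<^bsub>H\<^esub> \<one>\<^bsub>H\<^esub> \<in> U" using U by simp
    then obtain V W where VW: "openin S V" "openin S W" "\<one>\<^bsub>H\<^esub> \<in> V" "\<one>\<^bsub>H\<^esub> \<in> W"
        "\<And>a b. a \<in> V \<Longrightarrow> b \<in> W \<Longrightarrow> a \<otimes>\<^bsub>H\<^esub> b \<in> U"
      using topological_group_mult_nhds[OF H U(1) H.one_closed H.one_closed] by blast
    have "A ** B \<in> cl_preimage U" if "A \<in> cl_preimage V" "B \<in> cl_preimage W" for A B
      unfolding cl_preimage_def
      by (rule closure_image2[OF _ _ that[unfolded cl_preimage_def]])
        (auto intro!: continuous_intros simp: f_mult mult_mem_SL VW(5))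
    moreover have "eventually (\<lambda>A. A \<in> cl_preimage V) \<Phi>" "eventually (\<lambda>A. A \<in> cl_preimage W) \<Phi>"
      using VW by (auto simp: eventually_\<Phi>)
    ultimately show "eventually (\<lambda>z. P (case z of (A, B) \<Rightarrow> A ** B)) (\<Phi> \<times>\<^sub>F \<Phi>)"
      unfolding eventually_prod_filter using U(3)
      by (intro exI[of _ "\<lambda>A. A \<in> cl_preimage V"] exI[of _ "\<lambda>A. A \<in> cl_preimage W"]) auto
  qed
  show "filterlim adjugate \<Phi> \<Phi>"
    unfolding filterlim_iff
  proof (intro allI impI)
    fix P assume "eventually P \<Phi>"
    then obtain U where U: "openin S U" "\<one>\<^bsub>H\<^esub> \<in> U" "\<forall>A\<in>cl_preimage U. P A"
      by (auto simp: eventually_\<Phi>)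
    let ?V = "{x \<in> topspace S. inv\<^bsub>H\<^esub> x \<in> U}"
    have V: "openin S ?V" by (rule openin_continuous_map_preimage[OF HD(5) U(1)])
    have "adjugate A \<in> cl_preimage U" if "A \<in> cl_preimage ?V" for A
      unfolding cl_preimage_def
      by (rule closure_image1[OF _ _ that[unfolded cl_preimage_def]])
        (auto intro!: continuous_intros simp: f_adjugate adjugate_SL)
    then show "eventually (\<lambda>A. P (adjugate A)) \<Phi>"
      unfolding eventually_\<Phi> using V U HD(2) by (intro exI[of _ ?V]) auto
  qed
  fix U and A :: "complex ^ 'n ^ 'n" assume "open U" "A \<in> U" "det A = 1"
  then obtain g where g: "g \<in> U" "g \<in> carrier (SL F)" using SL_dense by blast
  have "filterlim (\<lambda>A. g ** A ** adjugate g) \<Phi> \<Phi>"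
    unfolding filterlim_iff
  proof (intro allI impI)
    fix P assume "eventually P \<Phi>"
    then obtain U where U: "openin S U" "\<one>\<^bsub>H\<^esub> \<in> U" "\<forall>A\<in>cl_preimage U. P A"
      by (auto simp: eventually_\<Phi>)
    let ?V = "{x \<in> topspace S. f g \<otimes>\<^bsub>H\<^esub> x \<otimes>\<^bsub>H\<^esub> inv\<^bsub>H\<^esub> (f g) \<in> U}"
    have "continuous_map S S ((\<lambda>x. x \<otimes>\<^bsub>H\<^esub> inv\<^bsub>H\<^esub> (f g)) \<circ> (\<lambda>x. f g \<otimes>\<^bsub>H\<^esub> x))"
      by (intro continuous_map_compose[OF topological_group_left_translation[OF H]
            topological_group_right_translation[OF H]]) (simp_all add: f_closed g)
    then have V: "openin S ?V"
      using openin_continuous_map_preimage[OF _ U(1)] by (fastforce simp: o_def)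
    have "g ** A ** adjugate g \<in> cl_preimage U" if "A \<in> cl_preimage ?V" for A
      unfolding cl_preimage_def
      by (rule closure_image1[OF _ _ that[unfolded cl_preimage_def]])
        (auto intro!: continuous_intros simp: f_adjugate adjugate_SL mult_mem_SL f_mult g)
    then show "eventually (\<lambda>A. P (g ** A ** adjugate g)) \<Phi>"
      unfolding eventually_\<Phi> using V U HD(2) g f_closed by (intro exI[of _ ?V]) auto
  qed
  then show "\<exists>g\<in>U. det g = 1 \<and> filterlim (\<lambda>A. g ** A ** adjugate g) \<Phi> \<Phi>"
    using g by (auto simp: carrier_SL)
qed

text \<open>If \<open>f u \<noteq> 1\<close>, separate the two points in \<open>H\<close>: the preimage of the neighbourhood of \<open>1\<close> then avoids a
neighbourhood of \<open>u\<close>, so that its closure does not contain \<open>u\<close>.\<close>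

lemma f_core:
  assumes "u \<in> core" "u \<in> carrier (SL F)"
  shows "f u = \<one>\<^bsub>H\<^esub>"
proof (rule ccontr)
  assume "f u \<noteq> \<one>\<^bsub>H\<^esub>"
  then obtain U V where UV: "openin S U" "openin S V" "f u \<in> U" "\<one>\<^bsub>H\<^esub> \<in> V" "disjnt U V"
    using HD(3) f_closed[OF assms(2)] H.one_closed unfolding Hausdorff_space_def HD(2) by metis
  obtain W where W: "open W" "\<forall>A\<in>carrier (SL F). f A \<in> U \<longleftrightarrow> A \<in> W"
    using open_preimage[OF UV(1)] by blast
  have "u \<in> cl_preimage V"
    by (rule coreD[OF assms(1)]) (use UV in \<open>auto simp: eventually_\<Phi>\<close>)
  moreover have "u \<in> W" using W(2) UV(3) assms(2) by blast
  ultimately have "{A \<in> carrier (SL F). f A \<in> V} \<inter> W \<noteq> {}"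
    using W(1) unfolding cl_preimage_def closure_iff_nhds_not_empty by blast
  then show False using W(2) UV(5) by (auto simp: disjnt_def)
qed

lemma open_map_if_core_trivial:
  assumes "\<And>A. A \<in> carrier (SL F) \<Longrightarrow> A \<in> core"
  shows "open_map (SL_topology F) S f"
  unfolding open_map_def
proof (intro allI impI)
  fix V :: "(complex ^ 'n ^ 'n) set" assume V: "openin (SL_topology F) V"
  have triv: "f A = \<one>\<^bsub>H\<^esub>" if "A \<in> carrier (SL F)" for A
    by (rule f_core[OF assms[OF that] that])
  have VG: "V \<subseteq> carrier (SL F)" using openin_subset[OF V] by (simp add: topspace_SL)
  have "carrier H \<subseteq> {\<one>\<^bsub>H\<^esub>}" unfolding surj[symmetric] using triv by auto
  then have "carrier H = {\<one>\<^bsub>H\<^esub>}" using H.one_closed by blast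
  moreover have "f ` V \<subseteq> {\<one>\<^bsub>H\<^esub>}" using triv VG by auto
  ultimately have "f ` V = {} \<or> f ` V = carrier H" by (simp add: subset_singleton_iff)
  then show "openin S (f ` V)" using HD(2) openin_topspace[of S] by auto
qed

text \<open>Up to a translation by \<open>x\<close>, consider a matrix whose image is close to \<open>1\<close>. It is close to some \<open>v\<close> in
the core, hence it is the product of \<open>v\<close> and a matrix close to the identity, which has the same image
because \<open>f v = 1\<close>. So the points of \<open>H\<close> close to \<open>1\<close> are images of matrices close to the identity.\<close>

lemma open_map_if_core_subset:
  assumes bdd: "eventually (\<lambda>A. norm A \<le> R) \<Phi>" and core: "core \<subseteq> carrier (SL F)"
  shows "open_map (SL_topology F) S f"
  unfolding open_map_def
proof (intro allI impI, subst openin_subopen, intro ballI)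
  fix V :: "(complex ^ 'n ^ 'n) set" and y assume V: "openin (SL_topology F) V" and "y \<in> f ` V"
  then obtain x where x: "x \<in> V" "y = f x" by blast
  obtain U where U: "open U" "V = U \<inter> carrier (SL F)"
    using V by (auto simp: SL_topology_def openin_subtopology)
  have xG: "x \<in> carrier (SL F)" using x U by blast
  \<comment> \<open>the matrices \<open>A\<close> for which \<open>x v\<^sup>-\<^sup>1 A\<close> lies in \<open>U\<close> for some \<open>v\<close> in the core\<close>
  define W where "W = (\<Union>v\<in>core. (\<lambda>A. x ** (adjugate v ** A)) -` U)"
  have "open W"
    unfolding W_def by (intro open_UN ballI open_vimage U(1) continuous_intros)
  moreover have "core \<subseteq> W"
  proof
    fix v assume v: "v \<in> core"
    have "x ** (adjugate v ** v) \<in> U"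
      using x(1) U(2) adjugate_left[OF core_det[OF v]] by simp
    then show "v \<in> W" using v unfolding W_def by blast
  qed
  ultimately have "eventually (\<lambda>A. A \<in> W) \<Phi>"
    by (rule bounded_imp_eventually_near_core[OF bdd])
  then obtain Y where Y: "openin S Y" "\<one>\<^bsub>H\<^esub> \<in> Y" "cl_preimage Y \<subseteq> W"
    by (auto simp: eventually_\<Phi>)
  define T where "T = {t \<in> topspace S. inv\<^bsub>H\<^esub> (f x) \<otimes>\<^bsub>H\<^esub> t \<in> Y}"
  have "openin S T"
    unfolding T_def by (intro openin_continuous_map_preimage[OF topological_group_left_translation[OF H] Y(1)])
      (simp add: f_closed xG)
  moreover have "y \<in> T" using x Y HD(2) f_closed[OF xG] by (simp add: T_def)
  moreover have "T \<subseteq> f ` V"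
  proof
    fix t assume t: "t \<in> T"
    then obtain a where a: "a \<in> carrier (SL F)" "t = f a" using HD(2) surj by (auto simp: T_def)
    let ?b = "adjugate x ** a"
    have b: "?b \<in> carrier (SL F)" by (simp add: mult_mem_SL adjugate_SL xG a)
    have "f ?b \<in> Y" using t a xG by (simp add: T_def f_mult adjugate_SL f_adjugate)
    then have "?b \<in> cl_preimage Y"
      unfolding cl_preimage_def using b by (intro closure_subset[THEN subsetD]) simp
    then obtain v where v: "v \<in> core" "x ** (adjugate v ** ?b) \<in> U" using Y(3) by (auto simp: W_def)
    then have vG: "v \<in> carrier (SL F)" "f v = \<one>\<^bsub>H\<^esub>" using core f_core by auto
    have "x ** (adjugate v ** ?b) \<in> V"
      using v U(2) by (simp add: mult_mem_SL adjugate_SL xG vG b)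
    moreover have "f (x ** (adjugate v ** ?b)) = t"
      using a xG vG b f_closed
      by (simp add: f_mult mult_mem_SL adjugate_SL f_adjugate H.m_assoc[symmetric])
    ultimately show "t \<in> f ` V" by blast
  qed
  ultimately show "\<exists>T. openin S T \<and> y \<in> T \<and> T \<subseteq> f ` V" by blast
qed

definition scalar_core :: "complex set" where
  "scalar_core = {c. c ^ CARD('n) = 1 \<and> mat c \<in> core}"

lemma mat_SL: "c \<in> F \<Longrightarrow> c ^ CARD('n) = 1 \<Longrightarrow> (mat c :: complex ^ 'n ^ 'n) \<in> carrier (SL F)"
  using zero_mem by (simp add: carrier_SL det_mat) (simp add: mat_def)

lemma scalar_core_mult: "a \<in> scalar_core \<Longrightarrow> b \<in> scalar_core \<Longrightarrow> a * b \<in> scalar_core"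
proof -
  have "mat (a * b) = (mat a ** mat b :: complex ^ 'n ^ 'n)"
    by (simp add: vec_eq_iff mat_mult_nth) (simp add: mat_def)
  then show "a \<in> scalar_core \<Longrightarrow> b \<in> scalar_core \<Longrightarrow> a * b \<in> scalar_core"
    using core_mult by (auto simp: scalar_core_def power_mult_distrib)
qed

lemma scalar_core_one: "1 \<in> scalar_core"
  by (simp add: scalar_core_def core_one)

lemma f_scalar_core: "c \<in> scalar_core \<Longrightarrow> c \<in> F \<Longrightarrow> f (mat c) = \<one>\<^bsub>H\<^esub>"
  using f_core mat_SL by (auto simp: scalar_core_def)

text \<open>If the core is everything, \<open>f\<close> is trivial; otherwise the core consists of scalar matrices only, and the
hypothesis puts it into \<open>SL(n,F)\<close>.\<close>

theorem open_map_if_scalar_core_subset: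
  assumes "scalar_core \<subseteq> F"
  shows "open_map (SL_topology F) S f"
proof (cases "\<exists>R. eventually (\<lambda>A. norm A \<le> R) \<Phi>")
  case True
  then obtain R where R: "eventually (\<lambda>A. norm A \<le> R) \<Phi>" by blast
  have "core \<subseteq> carrier (SL F)"
  proof
    fix u assume "u \<in> core"
    then obtain c where "c ^ CARD('n) = 1" "u = mat c" using bounded_imp_core_scalar[OF R] by blast
    then show "u \<in> carrier (SL F)" using \<open>u \<in> core\<close> assms mat_SL by (auto simp: scalar_core_def)
  qed
  then show ?thesis by (rule open_map_if_core_subset[OF R])
next
  case False
  then show ?thesis
    using unbounded_imp_core_everything by (intro open_map_if_core_trivial) (auto simp: carrier_SL)
qed

end

section \<open>Roots of unity\<close>

lemma rho_power: "rho m ^ j = exp (2 * of_real pi * \<i> * of_nat j / of_nat m)"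
  by (simp add: rho_def exp_of_nat_mult[symmetric] mult_ac)

lemma rho_group_eq:
  assumes "m \<ge> 1"
  shows "rho_group m = {c. c ^ m = 1}"
proof (intro subset_antisym subsetI)
  have rho1: "rho m ^ m = 1" using assms by (simp add: rho_power exp_two_pi_i)
  fix c assume "c \<in> rho_group m"
  then obtain k where "c = rho m powi k" by (auto simp: rho_group_def)
  then have "c ^ m = (rho m ^ m) powi k"
    by (simp add: power_int_power power_int_power' mult.commute)
  then show "c \<in> {c. c ^ m = 1}" using rho1 by simp
next
  fix c :: complex assume "c \<in> {c. c ^ m = 1}"
  then obtain j where "c = exp (2 * of_real pi * \<i> * of_nat j / of_nat m)"
    using complex_roots_unity[OF assms] by blast
  then have "c = rho m powi int j" by (simp add: rho_power)
  then show "c \<in> rho_group m" unfolding rho_group_def by (rule range_eqI)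
qed

lemma rho_in_rho_group: "rho m \<in> rho_group m"
  unfolding rho_group_def by (rule range_eqI[of _ _ 1]) simp

text \<open>If \<open>c \<noteq> 1\<close> in \<open>M\<close> has order \<open>m\<close>, its powers are \<open>m\<close> distinct roots of \<open>z\<^sup>m = 1\<close>, hence all of them.\<close>

lemma nontrivial_root_group_contains_rho_group:
  assumes one: "1 \<in> M" and mult: "\<And>a b. a \<in> M \<Longrightarrow> b \<in> M \<Longrightarrow> a * b \<in> M"
    and roots: "\<And>c. c \<in> M \<Longrightarrow> c ^ n = 1" and c: "c \<in> M" "c \<noteq> 1" and n: "n > 0"
  shows "\<exists>m>1. m dvd n \<and> rho_group m \<subseteq> M"
proof -
  define m where "m = (LEAST k. k > 0 \<and> c ^ k = 1)"
  have m: "m > 0" "c ^ m = 1"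
    using LeastI[of "\<lambda>k. k > 0 \<and> c ^ k = 1" n] n roots[OF c(1)] by (auto simp: m_def)
  have least: "\<not> (0 < k \<and> c ^ k = 1)" if "k < m" for k
    using that not_less_Least[of k "\<lambda>k. k > 0 \<and> c ^ k = 1"] by (simp add: m_def)
  have m1: "m > 1" using m c(2) by (cases "m = 1") auto
  have "c ^ n = (c ^ m) ^ (n div m) * c ^ (n mod m)"
    by (simp flip: power_mult power_add)
  then have "c ^ (n mod m) = 1" using m roots[OF c(1)] by simp
  then have "n mod m = 0" using least[of "n mod m"] m(1) by auto
  then have dvd: "m dvd n" by auto
  have c0: "c \<noteq> 0" using m by (auto simp: power_0_left)
  have "inj_on (\<lambda>k. c ^ k) {..<m}"
  proof (rule linorder_inj_onI)
    fix i j assume ij: "i < j" "i \<in> {..<m}" "j \<in> {..<m}"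
    show "c ^ i \<noteq> c ^ j"
    proof
      assume "c ^ i = c ^ j"
      then have "c ^ (j - i) = 1" using c0 ij(1) by (simp add: power_diff)
      moreover have "j - i < m" "0 < j - i" using ij by auto
      ultimately show False using least by blast
    qed
  qed auto
  then have "card ((\<lambda>k. c ^ k) ` {..<m}) = m" by (simp add: card_image)
  moreover have "(\<lambda>k. c ^ k) ` {..<m} \<subseteq> {z. z ^ m = 1}"
    using m(2) by (auto simp flip: power_mult simp: mult.commute[of _ m] power_mult)
  ultimately have eq: "(\<lambda>k. c ^ k) ` {..<m} = {z. z ^ m = 1}"
    using m1 by (intro card_subset_eq finite_roots_unity) (auto simp: card_complex_roots_unity)
  have "c ^ k \<in> M" for k by (induction k) (auto intro: one mult c)
  then have "{z. z ^ m = 1} \<subseteq> M" unfolding eq[symmetric] by auto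
  then have "rho_group m \<subseteq> M" using m1 by (simp add: rho_group_eq)
  then show ?thesis using m1 dvd by blast
qed

section \<open>Minimality and open homomorphisms\<close>

lemma minimal_group_if_open:
  assumes G: "topological_group G T"
    and op: "\<And>S. topological_group G S \<Longrightarrow> continuous_map T S id \<Longrightarrow> open_map T S id"
  shows "minimal_group G T"
  unfolding minimal_group_def
proof (intro conjI allI impI G)
  fix S assume S: "topological_group G S \<and> (\<forall>U. openin S U \<longrightarrow> openin T U)"
  have top: "topspace S = topspace T" using G S by (simp add: topological_group_def)
  have "{x \<in> topspace T. id x \<in> U} = U" if "openin S U" for U
    using openin_subset[OF that] top by auto
  then have "continuous_map T S id"
    unfolding continuous_map_def using S top by simp
  then have "open_map T S id" using op S by blast
  then show "S = T" using S by (auto simp: topology_eq open_map_def)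
qed

text \<open>By the isomorphism theorem \<open>f\<close> factors as the open quotient map by its kernel followed by a continuous
isomorphism, which is a homeomorphism since the quotient is minimal.\<close>

lemma totally_minimal_group_open_map:
  assumes min: "totally_minimal_group G T" and H: "topological_group H S"
    and f: "f \<in> hom G H" "f ` carrier G = carrier H" and cont: "continuous_map T S f"
  shows "open_map T S f"
proof -
  have G: "topological_group G T" using min by (simp add: totally_minimal_group_def)
  note D = topological_groupD[OF G] and HD = topological_groupD[OF H]
  interpret f: group_hom G H f using D(1) HD(1) f(1) by (simp add: group_hom_def group_hom_axioms_def)
  define N where "N = kernel G H f"
  have N: "N \<lhd> G" unfolding N_def by (rule f.normal_kernel)
  have "closedin T {x \<in> topspace T. f x \<in> {\<one>\<^bsub>H\<^esub>}}"
    by (rule closedin_continuous_map_preimage[OF cont])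
      (use HD in \<open>auto intro: closedin_Hausdorff_singleton\<close>)
  then have "closedin T N" by (simp add: N_def kernel_def D(2))
  then have minN: "minimal_group (G Mod N) (quotient_group_topology G T N)"
    using min N by (simp add: totally_minimal_group_def)
  define g where "g = (\<lambda>Y. the_elem (f ` Y))"
  have g_iso: "g \<in> iso (G Mod N) H"
    unfolding g_def N_def by (rule f.FactGroup_iso_set[OF f(2)])
  have gf: "g (N #>\<^bsub>G\<^esub> x) = f x" if x: "x \<in> carrier G" for x
  proof -
    have "f ` (N #>\<^bsub>G\<^esub> x) = {f x}"
    proof (intro subset_antisym subsetI)
      fix y assume "y \<in> f ` (N #>\<^bsub>G\<^esub> x)"
      then obtain k where "k \<in> carrier G" "f k = \<one>\<^bsub>H\<^esub>" "y = f (k \<otimes>\<^bsub>G\<^esub> x)"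
        by (auto simp: r_coset_def N_def kernel_def)
      then show "y \<in> {f x}" using x by simp
    next
      fix y assume "y \<in> {f x}"
      moreover have "x \<in> N #>\<^bsub>G\<^esub> x" by (rule f.G.rcos_self[OF x normal_imp_subgroup[OF N]])
      ultimately show "y \<in> f ` (N #>\<^bsub>G\<^esub> x)" by blast
    qed
    then show ?thesis by (simp add: g_def)
  qed
  have quot: "quotient_map T (quotient_group_topology G T N) (\<lambda>x. N #>\<^bsub>G\<^esub> x)"
    by (rule quotient_map_quotient_group_topology[OF D(2)])
  have "continuous_map T S (g \<circ> (\<lambda>x. N #>\<^bsub>G\<^esub> x))"
    by (rule continuous_map_eq[OF cont]) (simp add: gf D(2))
  then have "continuous_map (quotient_group_topology G T N) S g"
    by (rule continuous_compose_quotient_map[OF quot])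
  then have "homeomorphic_map (quotient_group_topology G T N) S g"
    by (rule minimal_groupD_iso[OF minN H g_iso])
  then have "open_map T S (g \<circ> (\<lambda>x. N #>\<^bsub>G\<^esub> x))"
    by (intro open_map_compose[OF open_map_r_coset[OF G N]] homeomorphic_imp_open_map)
  then show ?thesis
    by (rule open_map_eq) (simp add: gf D(2))
qed

lemma topological_group_subgroup:
  assumes G: "topological_group G T" and K: "subgroup K G"
  shows "topological_group (G\<lparr>carrier := K\<rparr>) (subtopology T K)"
  unfolding topological_group_def
proof (intro conjI)
  note D = topological_groupD[OF G]
  interpret G: Group.group G by (rule D(1))
  have sub: "K \<subseteq> topspace T" using subgroup.subset[OF K] D(2) by simp
  show "Group.group (G\<lparr>carrier := K\<rparr>)" by (rule subgroup.subgroup_is_group[OF K D(1)])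
  show "topspace (subtopology T K) = carrier (G\<lparr>carrier := K\<rparr>)" using sub by auto
  show "Hausdorff_space (subtopology T K)" by (rule Hausdorff_space_subtopology[OF D(3)])
  show "continuous_map (prod_topology (subtopology T K) (subtopology T K)) (subtopology T K)
      (\<lambda>(x, y). x \<otimes>\<^bsub>G\<lparr>carrier := K\<rparr>\<^esub> y)"
    unfolding prod_topology_subtopology
    using subgroup.m_closed[OF K]
    by (intro continuous_map_into_subtopology)
      (auto simp: subtopology_subtopology intro!: continuous_map_from_subtopology D(4))
  have "continuous_map (subtopology T K) (subtopology T K) (\<lambda>x. inv\<^bsub>G\<^esub> x)"
    using subgroup.m_inv_closed[OF K]
    by (intro continuous_map_into_subtopology continuous_map_from_subtopology D(5)) auto
  then show "continuous_map (subtopology T K) (subtopology T K) (\<lambda>x. inv\<^bsub>G\<lparr>carrier := K\<rparr>\<^esub> x)"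
    by (rule continuous_map_eq) (simp add: G.m_inv_consistent[OF K])
qed

section \<open>Projective images of the special linear group\<close>

text \<open>The quotient of \<open>SL(n,\<complex>)\<close> by a group \<open>M\<close> of scalars, and the image of \<open>SL(n,F)\<close> in it.\<close>

locale scalar_quotient = dense_complex_subfield F
  for F :: "complex set" +
  fixes M :: "complex set" and N :: "(complex ^ 'n ^ 'n) set"
  assumes N_def: "N = mat ` M"
    and one_M: "1 \<in> M" and mult_M: "\<And>a b. a \<in> M \<Longrightarrow> b \<in> M \<Longrightarrow> a * b \<in> M"
    and roots_M: "\<And>c. c \<in> M \<Longrightarrow> c ^ CARD('n) = 1"
begin

sublocale U: complex_subfield UNIV
  by (rule complex_subfield_UNIV)

abbreviation L :: "(complex ^ 'n ^ 'n) monoid" where "L \<equiv> SL UNIV"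
abbreviation G :: "(complex ^ 'n ^ 'n) monoid" where "G \<equiv> SL F"
abbreviation q :: "complex ^ 'n ^ 'n \<Rightarrow> (complex ^ 'n ^ 'n) set" where "q A \<equiv> N #>\<^bsub>L\<^esub> A"
abbreviation Q where "Q \<equiv> L Mod N"
abbreviation TQ where "TQ \<equiv> quotient_group_topology L (SL_topology UNIV) N"

lemma finite_M: "finite M"
  by (rule finite_subset[OF _ finite_roots_unity[of "CARD('n)"]]) (auto simp: roots_M Suc_leI)

lemma inverse_M: "c \<in> M \<Longrightarrow> c ^ (CARD('n) - 1) \<in> M \<and> c * c ^ (CARD('n) - 1) = 1"
proof
  assume c: "c \<in> M"
  have "c ^ k \<in> M" for k by (induction k) (auto intro: one_M mult_M c)
  then show "c ^ (CARD('n) - 1) \<in> M" .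
  show "c * c ^ (CARD('n) - 1) = 1"
    using roots_M[OF c] by (simp flip: power_Suc)
qed

lemma N_L: "N \<subseteq> carrier L"
  using roots_M by (auto simp: N_def U.carrier_SL det_mat)

lemma normal_N: "N \<lhd> L"
proof (rule group.normal_invI[OF U.group_SL])
  have inv_N: "inv\<^bsub>L\<^esub> (mat c) = mat (c ^ (CARD('n) - 1))" if "c \<in> M" for c
    using inverse_M[OF that] that N_L
    by (subst U.inv_SL) (auto simp: N_def mat_mult_mat U.carrier_SL intro!: adjugate_unique[symmetric])
  show "subgroup N L"
  proof (rule group.subgroupI[OF U.group_SL N_L])
    show "N \<noteq> {}" using one_M by (auto simp: N_def)
    show "inv\<^bsub>L\<^esub> a \<in> N" if "a \<in> N" for a
      using that inv_N inverse_M by (auto simp: N_def)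
    show "a \<otimes>\<^bsub>L\<^esub> b \<in> N" if "a \<in> N" "b \<in> N" for a b
      using that by (auto simp: N_def U.mult_SL mat_mult_mat intro: mult_M)
  qed
  show "x \<otimes>\<^bsub>L\<^esub> h \<otimes>\<^bsub>L\<^esub> inv\<^bsub>L\<^esub> x \<in> N" if "x \<in> carrier L" "h \<in> N" for x h
  proof -
    from that(2) obtain c where c: "h = mat c" by (auto simp: N_def)
    have "x ** mat c ** adjugate x = mat c ** (x ** adjugate x)"
      by (simp only: mat_commute[of c x, symmetric] matrix_mul_assoc)
    also have "\<dots> = mat c"
      using that(1) by (simp add: adjugate_right U.carrier_SL)
    finally have "x ** mat c ** adjugate x = mat c" .
    then show ?thesis using that by (simp add: U.mult_SL U.inv_SL c)
  qed
qed

lemma closed_N: "closedin (SL_topology UNIV) N"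
  unfolding SL_topology_def using finite_M
  by (intro closed_subset N_L finite_imp_closed) (simp add: N_def)

lemma topological_group_Q: "topological_group Q TQ"
  by (rule topological_group_Mod[OF U.topological_group_SL normal_N closed_N])

lemma subgroup_G: "subgroup (carrier G) L"
proof (rule group.subgroupI[OF U.group_SL])
  show "carrier G \<subseteq> carrier L" by (auto simp: carrier_SL U.carrier_SL)
  show "carrier G \<noteq> {}" using group.is_monoid[OF group_SL, THEN monoid.one_closed] by blast
  show "inv\<^bsub>L\<^esub> A \<in> carrier G" if "A \<in> carrier G" for A
    using that U.inv_SL[of A] adjugate_SL[OF that] by (simp add: carrier_SL U.carrier_SL)
  show "A \<otimes>\<^bsub>L\<^esub> B \<in> carrier G" if "A \<in> carrier G" "B \<in> carrier G" for A B
    using mult_mem_SL[OF that] by (simp add: U.mult_SL)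
qed

lemma q_hom: "q \<in> hom L Q"
  by (rule normal.r_coset_hom_Mod[OF normal_N])

lemma subgroup_K: "subgroup (q ` carrier G) Q"
proof -
  interpret group_hom L Q q
    using q_hom U.group_SL topological_groupD(1)[OF topological_group_Q]
    by (simp add: group_hom_def group_hom_axioms_def)
  show ?thesis by (rule subgroup_img_is_subgroup[OF subgroup_G])
qed

abbreviation H where "H \<equiv> Q\<lparr>carrier := q ` carrier G\<rparr>"
abbreviation TH where "TH \<equiv> subtopology TQ (q ` carrier G)"

lemma topological_group_H: "topological_group H TH"
  by (rule topological_group_subgroup[OF topological_group_Q subgroup_K])

lemma q_hom_H: "q \<in> hom G H"
proof -
  have "q (A ** B) = q A \<otimes>\<^bsub>Q\<^esub> q B" if "A \<in> carrier G" "B \<in> carrier G" for A B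
    using hom_mult[OF q_hom, of A B] that by (simp add: carrier_SL U.carrier_SL U.mult_SL)
  then show ?thesis by (auto simp: hom_def mult_SL)
qed

lemma q_cont: "continuous_map (SL_topology F) TH q"
proof -
  have "continuous_map (SL_topology UNIV) TQ q"
    by (rule quotient_imp_continuous_map[OF quotient_map_quotient_group_topology[OF U.topspace_SL]])
  then have "continuous_map (subtopology (SL_topology UNIV) (carrier G)) TQ q"
    by (rule continuous_map_from_subtopology)
  moreover have "subtopology (SL_topology UNIV) (carrier G) = SL_topology F"
    using subgroup.subset[OF subgroup_G]
    by (simp add: SL_topology_def subtopology_subtopology inf_absorb2)
  ultimately show ?thesis
    by (intro continuous_map_into_subtopology) (auto simp: topspace_SL)
qed

lemma q_eqD:
  assumes "A \<in> carrier G" "B \<in> carrier G" "q B = q A"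
  obtains c where "c \<in> M" "c \<in> F" "B = mat c ** A"
proof -
  have "B \<in> q B"
    using assms(2) subgroup.subset[OF subgroup_G]
    by (intro group.rcos_self[OF U.group_SL _ normal_imp_subgroup[OF normal_N]]) auto
  then have "B \<in> q A" by (simp add: assms(3))
  then obtain c where c: "c \<in> M" "B = mat c ** A" by (auto simp: r_coset_def N_def U.mult_SL)
  have "B ** adjugate A = mat c"
    using assms(1) by (simp add: c matrix_mul_assoc[symmetric] adjugate_right carrier_SL)
  moreover have "B ** adjugate A \<in> carrier G"
    by (intro mult_mem_SL adjugate_SL assms)
  ultimately have "(mat c :: complex ^ 'n ^ 'n) $ i $ i \<in> F" for i by (simp add: carrier_SL)
  then have "c \<in> F" by (simp add: mat_def)
  then show ?thesis using that c by blast
qed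

text \<open>Suppose \<open>c \<in> M\<close> is not in \<open>F\<close>. Choose a neighbourhood \<open>U\<close> of the identity so small that its multiples by
the finitely many elements of \<open>M \<inter> F\<close> stay away from the scalar matrix \<open>c\<close>. The image of \<open>U\<close> is open and
contains that of \<open>c\<close>, so a matrix of \<open>SL(n,F)\<close> sufficiently close to \<open>c\<close> has its image there, and is thus
a multiple of an element of \<open>U\<close> by an element of \<open>M \<inter> F\<close>, a contradiction.\<close>

theorem open_map_imp_M_subset:
  assumes "open_map (SL_topology F) TH q"
  shows "M \<subseteq> F"
proof
  fix c assume c: "c \<in> M"
  show "c \<in> F"
  proof (rule ccontr)
    assume cF: "c \<notin> F"
    have "finite (mat ` (M \<inter> F) :: (complex ^ 'n ^ 'n) set)" using finite_M by simp
    then obtain d where d: "d > 0"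
      "\<And>Y :: complex ^ 'n ^ 'n. Y \<in> mat ` (M \<inter> F) \<Longrightarrow> Y \<noteq> mat c \<Longrightarrow> d \<le> dist (mat c) Y"
      using finite_set_avoid by metis
    define U :: "(complex ^ 'n ^ 'n) set" where
      "U = (\<Inter>a\<in>M \<inter> F. (\<lambda>A. mat a ** A) -` ball (mat a) (d / 2))"
    have "open U"
      unfolding U_def using finite_M
      by (intro open_INT ballI open_vimage open_ball continuous_intros) auto
    then have "openin (SL_topology F) (carrier G \<inter> U)"
      by (auto simp: SL_topology_def openin_subtopology)
    then have "openin TH (q ` (carrier G \<inter> U))" using assms by (simp add: open_map_def)
    then obtain W where W: "openin TQ W" "q ` (carrier G \<inter> U) = W \<inter> q ` carrier G"
      by (auto simp: openin_subtopology)
    have "openin (SL_topology UNIV) {A \<in> topspace (SL_topology UNIV). q A \<in> W}"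
      using W(1) by (simp add: openin_quotient_group_topology)
    then obtain V where V: "open V" "{A \<in> carrier L. q A \<in> W} = V \<inter> carrier L"
      unfolding U.topspace_SL by (auto simp: SL_topology_def openin_subtopology)
    have one: "mat 1 \<in> carrier G \<inter> U"
      using d(1) subgroup.one_closed[OF subgroup_G] by (auto simp: U_def U.one_SL)
    have qN: "q A = N" if "A \<in> N" for A
      using that N_L
      by (intro group.coset_join2[OF U.group_SL _ normal_imp_subgroup[OF normal_N]]) auto
    have "mat c \<in> N" "mat 1 \<in> N" using c one_M by (auto simp: N_def)
    then have "q (mat c) = q (mat 1)" by (simp add: qN)
    then have "q (mat c) \<in> W" using one W(2) by auto
    then have "mat c \<in> V \<inter> ball (mat c) (d / 2)" using V(2) \<open>mat c \<in> N\<close> N_L d(1) by auto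
    moreover have "det (mat c :: complex ^ 'n ^ 'n) = 1" by (simp add: det_mat roots_M c)
    moreover have "open (V \<inter> ball (mat c) (d / 2))" using V(1) by auto
    ultimately obtain B where B: "B \<in> V \<inter> ball (mat c) (d / 2)" "B \<in> carrier G"
      using SL_dense by blast
    have "B \<in> carrier L" using B(2) subgroup.subset[OF subgroup_G] by blast
    then have "q B \<in> q ` (carrier G \<inter> U)" using B V(2) W(2) by auto
    then obtain A where A: "A \<in> carrier G" "A \<in> U" "q B = q A" by blast
    obtain a where a: "a \<in> M" "a \<in> F" "B = mat a ** A" by (rule q_eqD[OF A(1) B(2) A(3)])
    have "dist (mat a) B < d / 2" using A(2) a by (auto simp: U_def)
    moreover have "dist (mat c) B < d / 2" using B(1) by simp
    moreover have "d \<le> dist (mat c) (mat a :: complex ^ 'n ^ 'n)"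
      using a cF by (intro d(2)) (auto simp: mat_inject)
    moreover have "dist (mat c) (mat a :: complex ^ 'n ^ 'n) \<le> dist (mat c) B + dist (mat a) B"
      by (rule dist_triangle2)
    ultimately show False by linarith
  qed
qed

lemma totally_minimal_imp_M_subset:
  assumes "totally_minimal_group G (SL_topology F)"
  shows "M \<subseteq> F"
  by (intro open_map_imp_M_subset
      totally_minimal_group_open_map[OF assms topological_group_H q_hom_H _ q_cont]) simp

lemma minimal_imp_M_subset:
  assumes min: "minimal_group G (SL_topology F)" and MF: "M \<inter> F = {1}"
  shows "M \<subseteq> F"
proof -
  have "inj_on q (carrier G)"
  proof (rule inj_onI)
    fix A B assume "A \<in> carrier G" "B \<in> carrier G" "q A = q B"
    then obtain c where "c \<in> M" "c \<in> F" "A = mat c ** B" using q_eqD by metis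
    moreover then have "c = 1" using MF by blast
    ultimately show "A = B" by simp
  qed
  then have "q \<in> iso G H" using q_hom_H by (auto simp: iso_def bij_betw_def)
  then have "homeomorphic_map (SL_topology F) TH q"
    by (rule minimal_groupD_iso[OF min topological_group_H _ q_cont])
  then show ?thesis by (intro open_map_imp_M_subset homeomorphic_imp_open_map)
qed

end

section \<open>The criterion\<close>

context dense_complex_subfield
begin

text \<open>A nontrivial \<open>scalar_core\<close> would contain some \<open>rho_group m\<close> with \<open>m > 1\<close>, whose nontrivial elements in
\<open>F\<close> are mapped to \<open>1\<close>; but the identity map is injective.\<close>

lemma minimal_SL:
  assumes ess: "\<And>m. m > 1 \<Longrightarrow> m dvd CARD('n) \<Longrightarrow> rho_group m \<inter> F \<noteq> {1}"
  shows "minimal_group (SL F :: (complex ^ 'n ^ 'n) monoid) (SL_topology F)"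
proof (rule minimal_group_if_open[OF topological_group_SL])
  fix S :: "(complex ^ 'n ^ 'n) topology"
  assume S: "topological_group (SL F) S" "continuous_map (SL_topology F) S id"
  interpret f: SL_quotient F "SL F" S id
    by unfold_locales (use S in \<open>auto simp: hom_def\<close>)
  have "f.scalar_core = {1}"
  proof (rule ccontr)
    assume "f.scalar_core \<noteq> {1}"
    then obtain c where c: "c \<in> f.scalar_core" "c \<noteq> 1" using f.scalar_core_one by blast
    have roots: "b ^ CARD('n) = 1" if "b \<in> f.scalar_core" for b
      using that by (simp add: f.scalar_core_def)
    have "CARD('n) > 0" by simp
    then obtain m where m: "m > 1" "m dvd CARD('n)" "rho_group m \<subseteq> f.scalar_core"
      using nontrivial_root_group_contains_rho_group[OF f.scalar_core_one f.scalar_core_mult roots c]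
      by blast
    have "1 \<in> rho_group m \<inter> F" using m(1) one_mem by (simp add: rho_group_eq)
    then obtain d where d: "d \<in> rho_group m" "d \<in> F" "d \<noteq> 1" using ess[OF m(1,2)] by blast
    then have "id (mat d :: complex ^ 'n ^ 'n) = mat 1"
      using f.f_scalar_core m(3) by (simp add: one_SL subset_iff)
    then show False using d(3) by (simp add: mat_inject)
  qed
  then show "open_map (SL_topology F) S id"
    by (intro f.open_map_if_scalar_core_subset) (simp add: one_mem)
qed

lemma totally_minimal_SL:
  assumes "rho CARD('n) \<in> F"
  shows "totally_minimal_group (SL F :: (complex ^ 'n ^ 'n) monoid) (SL_topology F)"
  unfolding totally_minimal_group_def
proof (intro conjI allI impI topological_group_SL)
  let ?G = "SL F :: (complex ^ 'n ^ 'n) monoid"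
  fix N assume N: "N \<lhd> ?G \<and> closedin (SL_topology F) N"
  let ?q = "\<lambda>A. N #>\<^bsub>?G\<^esub> A" and ?T = "quotient_group_topology ?G (SL_topology F) N"
  have Q: "topological_group (?G Mod N) ?T"
    using topological_group_Mod[OF topological_group_SL] N by blast
  have quot: "quotient_map (SL_topology F) ?T ?q"
    by (rule quotient_map_quotient_group_topology[OF topspace_SL])
  have im: "?q ` carrier ?G = carrier (?G Mod N)"
    by (auto simp: FactGroup_def RCOSETS_def)
  show "minimal_group (?G Mod N) ?T"
  proof (rule minimal_group_if_open[OF Q])
    fix S assume S: "topological_group (?G Mod N) S" "continuous_map ?T S id"
    have cont: "continuous_map (SL_topology F) S ?q"
      using continuous_map_compose[OF quotient_imp_continuous_map[OF quot] S(2)] by simp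
    interpret f: SL_quotient F "?G Mod N" S ?q
      by unfold_locales (use S(1) N cont im in \<open>auto intro: normal.r_coset_hom_Mod\<close>)
    have "{c. c ^ CARD('n) = 1} \<subseteq> F"
    proof
      fix c :: complex assume "c \<in> {c. c ^ CARD('n) = 1}"
      then obtain j where "c = rho CARD('n) ^ j"
        using complex_roots_unity[of "CARD('n)"] by (auto simp: rho_power Suc_leI)
      then show "c \<in> F" using assms power_mem by simp
    qed
    then have op: "open_map (SL_topology F) S ?q"
      by (intro f.open_map_if_scalar_core_subset) (auto simp: f.scalar_core_def)
    show "open_map ?T S id"
      unfolding open_map_def
    proof (intro allI impI)
      fix U assume U: "openin ?T U"
      then have "openin S (?q ` {A \<in> topspace (SL_topology F). ?q A \<in> U})"
        using op by (simp add: openin_quotient_group_topology open_map_def)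
      moreover have "?q ` {A \<in> topspace (SL_topology F). ?q A \<in> U} = U"
      proof (intro subset_antisym subsetI)
        fix y assume y: "y \<in> U"
        then have "y \<in> ?q ` carrier ?G" using U im by (auto simp: openin_quotient_group_topology)
        then show "y \<in> ?q ` {A \<in> topspace (SL_topology F). ?q A \<in> U}"
          using y by (auto simp: topspace_SL)
      qed auto
      ultimately show "openin S (id ` U)" by simp
    qed
  qed
qed

end

theorem proposition2p12:
  fixes F :: "complex set"
  assumes "subfield F (ring_of_type_algebra :: complex ring)"
    and "closure F = UNIV"
  shows "(totally_minimal_group (SL F :: (complex ^ 'n::finite ^ 'n) monoid) (SL_topology F) \<longleftrightarrow>
            rho CARD('n) \<in> F) \<and>
         (minimal_group (SL F :: (complex ^ 'n ^ 'n) monoid) (SL_topology F) \<longleftrightarrow>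
            (\<forall>m::nat. m > 1 \<and> m dvd CARD('n) \<longrightarrow> rho_group m \<inter> F \<noteq> {1}))"
proof -
  interpret dense_complex_subfield F
    using complex_subfield_subfield[OF assms(1)] assms(2)
    by (simp add: dense_complex_subfield_def dense_complex_subfield_axioms_def)
  have quot: "scalar_quotient F (rho_group m) (mat ` rho_group m :: (complex ^ 'n ^ 'n) set)"
    if m: "m > 0" "m dvd CARD('n)" for m
  proof unfold_locales
    show "c ^ CARD('n) = 1" if "c \<in> rho_group m" for c
      using that m by (auto simp: rho_group_eq Suc_leI power_mult elim!: dvdE)
  qed (use m in \<open>auto simp: rho_group_eq Suc_leI power_mult_distrib\<close>)
  show ?thesis
  proof (intro conjI iffI allI impI)
    assume "totally_minimal_group (SL F :: (complex ^ 'n ^ 'n) monoid) (SL_topology F)"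
    then show "rho CARD('n) \<in> F"
      using scalar_quotient.totally_minimal_imp_M_subset[OF quot[of "CARD('n)"]]
        rho_in_rho_group[of "CARD('n)"] by auto
  next
    fix m :: nat
    assume min: "minimal_group (SL F :: (complex ^ 'n ^ 'n) monoid) (SL_topology F)"
      and m: "1 < m \<and> m dvd CARD('n)"
    show "rho_group m \<inter> F \<noteq> {1}"
    proof
      assume triv: "rho_group m \<inter> F = {1}"
      have "rho_group m \<subseteq> F"
        using scalar_quotient.minimal_imp_M_subset[OF quot min triv] m by simp
      then have "rho_group m = {1}" using triv by blast
      then have "card {c :: complex. c ^ m = 1} = 1" using m by (simp add: rho_group_eq)
      then show False using m card_complex_roots_unity[of m] by simp
    qed
  qed (use minimal_SL totally_minimal_SL in auto)
qed

end
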